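(* Let $M$ be a compact Poisson manifold with Poisson bracket $\{\cdot,\cdot\}$ whose symplectic leaves are of codimension $\ge 1$, and let $\lambda:M\to\mathbb{R}$ be a smooth non-constant Casimir function on $M$. Let $\mathrm{Dens}$ be the space of smooth volume forms on $M$ with total integral $1$, equipped with the Poisson bracket $\{\cdot,\cdot\}_{\mathrm{Dens}}$. Then the Poisson bracket $\{\cdot,\cdot\}_{\mathrm{Dens}}$ admits infinitely many functionally independent Casimirs. Namely, for any function $h:\mathbb{R}\to\mathbb{R}$, the functional $$C_{h,\lambda}(d\nu):=\int_M (h\circ\lambda)\,d\nu$$ is a Casimir on the density space $\mathrm{Dens}$.
   Context: $\mathrm{Dens}$ is the set of smooth volume forms on $M$ with total integral $1$, regarded as an infinite-dimensional smooth manifold. Each $f\in C^\infty(M)$ defines a linear functional $F_f(d\nu):=\int_M f\,d\nu$ on $\mathrm{Dens}$. The Poisson bracket on $\mathrm{Dens}$ is determined on these linear functionals by $\{F_f,F_g\}_{\mathrm{Dens}}(d\nu):=F_{\{f,g\}}(d\nu)=\int_M\{f,g\}\,d\nu$. The symplectic leaves of $\{\cdot,\cdot\}_{\mathrm{Dens}}$ are the orbits in $\mathrm{Dens}$ of the natural action on densities of the group of Hamiltonian diffeomorphisms of $M$ (the group generated by flows of Hamiltonian vector fields on $M$). A Casimir function on a Poisson manifold (either $M$ or $\mathrm{Dens}$) is a function constant on symplectic leaves.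
   Formalization: M is taken to be connected (and oriented, so that volume forms exist); without connectedness λ could be locally constant, as on two disjoint circles with zero bracket, and the functionals C_{h,λ} would not give infinitely many independent Casimirs. *)

theory Defs
  imports "HOL-Analysis.Analysis"
begin

section \<open>Smooth maps between open subsets of Euclidean spaces\<close>

text \<open>Only used for open \<open>S\<close>; the class \<open>C\<^sup>k\<close> is described by iterated directional derivatives.\<close>

fun Ck_on :: "nat \<Rightarrow> 'a::euclidean_space set \<Rightarrow> ('a \<Rightarrow> 'b::real_normed_vector) \<Rightarrow> bool" where
  "Ck_on 0 S f \<longleftrightarrow> continuous_on S f"
| "Ck_on (Suc k) S f \<longleftrightarrow> (\<forall>x\<in>S. f differentiable (at x)) \<and>
     (\<forall>v. Ck_on k S (\<lambda>x. frechet_derivative f (at x) v))"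

definition smooth_on :: "'a::euclidean_space set \<Rightarrow> ('a \<Rightarrow> 'b::real_normed_vector) \<Rightarrow> bool" where
  "smooth_on S f \<longleftrightarrow> (\<forall>k. Ck_on k S f)"

definition jacobian_det :: "(real^'n \<Rightarrow> real^'n) \<Rightarrow> real^'n \<Rightarrow> real" where
  "jacobian_det f u = det (matrix (frechet_derivative f (at u)))"


section \<open>Smooth manifolds\<close>

text \<open>
  The manifold \<open>M\<close> is the whole type \<open>'m\<close>, with an atlas of charts \<open>(U, \<phi>)\<close>, \<open>\<phi> : U \<rightarrow> \<real>\<^sup>n\<close>.
  The coordinates are indexed by a type of class \<open>{finite,wellorder}\<close>, as in the change of variables
  theorems of \<open>HOL-Analysis\<close>; the numeral types provide such an index type in every dimension.
\<close>

type_synonym ('m, 'n) chart = "'m set \<times> ('m \<Rightarrow> real^'n)"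

abbreviation chart_dom :: "('m, 'n) chart \<Rightarrow> 'm set" where
  "chart_dom c \<equiv> fst c"

abbreviation chart_map :: "('m, 'n) chart \<Rightarrow> 'm \<Rightarrow> real^'n" where
  "chart_map c \<equiv> snd c"

abbreviation chart_image :: "('m, 'n) chart \<Rightarrow> (real^'n) set" where
  "chart_image c \<equiv> chart_map c ` chart_dom c"

definition chart_inv :: "('m, 'n) chart \<Rightarrow> real^'n \<Rightarrow> 'm" where
  "chart_inv c = inv_into (chart_dom c) (chart_map c)"

definition is_chart :: "('m::topological_space, 'n::finite) chart \<Rightarrow> bool" where
  "is_chart c \<longleftrightarrow> open (chart_dom c) \<and> open (chart_image c) \<and>
     homeomorphism (chart_dom c) (chart_image c) (chart_map c) (chart_inv c)"

definition coord_change :: "('m, 'n) chart \<Rightarrow> ('m, 'n) chart \<Rightarrow> real^'n \<Rightarrow> real^'n" where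
  "coord_change c d = chart_map d \<circ> chart_inv c"

definition smooth_atlas :: "('m::topological_space, 'n::finite) chart set \<Rightarrow> bool" where
  "smooth_atlas A \<longleftrightarrow> (\<forall>c\<in>A. is_chart c) \<and> (\<Union>c\<in>A. chart_dom c) = UNIV \<and>
     (\<forall>c\<in>A. \<forall>d\<in>A. smooth_on (chart_map c ` (chart_dom c \<inter> chart_dom d)) (coord_change c d))"

text \<open>Integration of top-degree forms needs an orientation, given here by an oriented atlas.\<close>

definition oriented_atlas :: "('m::topological_space, 'n::finite) chart set \<Rightarrow> bool" where
  "oriented_atlas A \<longleftrightarrow> smooth_atlas A \<and>
     (\<forall>c\<in>A. \<forall>d\<in>A. \<forall>x\<in>chart_dom c \<inter> chart_dom d.
        jacobian_det (coord_change c d) (chart_map c x) > 0)"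

text \<open>
  Connectedness is part of the notion of a manifold.  The Hausdorff property comes from the sort
  of \<open>'m\<close>, and second countability follows from compactness.
\<close>

definition compact_oriented_manifold :: "('m::t2_space, 'n::finite) chart set \<Rightarrow> bool" where
  "compact_oriented_manifold A \<longleftrightarrow>
     oriented_atlas A \<and> compact (UNIV :: 'm set) \<and> connected (UNIV :: 'm set)"

definition smooth_fun :: "('m, 'n::finite) chart set \<Rightarrow> ('m \<Rightarrow> real) \<Rightarrow> bool" where
  "smooth_fun A f \<longleftrightarrow> (\<forall>c\<in>A. smooth_on (chart_image c) (f \<circ> chart_inv c))"


section \<open>Poisson structures\<close>

definition poisson_bracket ::
  "('m, 'n::finite) chart set \<Rightarrow> (('m \<Rightarrow> real) \<Rightarrow> ('m \<Rightarrow> real) \<Rightarrow> ('m \<Rightarrow> real)) \<Rightarrow> bool" where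
  "poisson_bracket A P \<longleftrightarrow>
     (\<forall>f g. smooth_fun A f \<longrightarrow> smooth_fun A g \<longrightarrow> smooth_fun A (P f g)) \<and>
     (\<forall>f g h a b. smooth_fun A f \<longrightarrow> smooth_fun A g \<longrightarrow> smooth_fun A h \<longrightarrow>
        P (\<lambda>x. a * f x + b * g x) h = (\<lambda>x. a * P f h x + b * P g h x)) \<and>
     (\<forall>f g. smooth_fun A f \<longrightarrow> smooth_fun A g \<longrightarrow> P f g = (\<lambda>x. - P g f x)) \<and>
     (\<forall>f g h. smooth_fun A f \<longrightarrow> smooth_fun A g \<longrightarrow> smooth_fun A h \<longrightarrow>
        P f (\<lambda>x. g x * h x) = (\<lambda>x. P f g x * h x + g x * P f h x)) \<and>
     (\<forall>f g h. smooth_fun A f \<longrightarrow> smooth_fun A g \<longrightarrow> smooth_fun A h \<longrightarrow>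
        (\<lambda>x. P f (P g h) x + P g (P h f) x + P h (P f g) x) = (\<lambda>x. 0))"

text \<open>
  The Hamiltonian vector field of \<open>f\<close> is the derivation \<open>g \<mapsto> {g, f}\<close>; a curve \<open>\<gamma>\<close> is an integral
  curve if its velocity, as a derivation on smooth functions, is the value of the field.
\<close>

definition ham_integral_curve ::
  "('m::topological_space, 'n::finite) chart set \<Rightarrow> (('m \<Rightarrow> real) \<Rightarrow> ('m \<Rightarrow> real) \<Rightarrow> ('m \<Rightarrow> real)) \<Rightarrow>
   ('m \<Rightarrow> real) \<Rightarrow> real set \<Rightarrow> (real \<Rightarrow> 'm) \<Rightarrow> bool" where
  "ham_integral_curve A P f I \<gamma> \<longleftrightarrow> continuous_on I \<gamma> \<and>
     (\<forall>g. smooth_fun A g \<longrightarrow> (\<forall>t\<in>I.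
        ((\<lambda>s. g (\<gamma> s)) has_real_derivative P g f (\<gamma> t)) (at t within I)))"

text \<open>The symplectic leaf of \<open>x\<close>: points reached from \<open>x\<close> along finitely many Hamiltonian curves.\<close>

definition ham_connected ::
  "('m::topological_space, 'n::finite) chart set \<Rightarrow> (('m \<Rightarrow> real) \<Rightarrow> ('m \<Rightarrow> real) \<Rightarrow> ('m \<Rightarrow> real)) \<Rightarrow>
   ('m \<times> 'm) set" where
  "ham_connected A P = {(x, y). \<exists>f \<gamma> a b. smooth_fun A f \<and> a \<le> b \<and>
     ham_integral_curve A P f {a..b} \<gamma> \<and> \<gamma> a = x \<and> \<gamma> b = y}"

definition symplectic_leaf ::
  "('m::topological_space, 'n::finite) chart set \<Rightarrow> (('m \<Rightarrow> real) \<Rightarrow> ('m \<Rightarrow> real) \<Rightarrow> ('m \<Rightarrow> real)) \<Rightarrow>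
   'm \<Rightarrow> 'm set" where
  "symplectic_leaf A P x = {y. (x, y) \<in> (ham_connected A P)\<^sup>*}"

text \<open>
  The tangent space at \<open>x\<close> of the leaf through \<open>x\<close>, expressed in the chart \<open>c\<close>: the coordinate
  vectors \<open>v\<close> of the values at \<open>x\<close> of Hamiltonian vector fields.
\<close>

definition leaf_tangent_space ::
  "('m, 'n::finite) chart set \<Rightarrow> (('m \<Rightarrow> real) \<Rightarrow> ('m \<Rightarrow> real) \<Rightarrow> ('m \<Rightarrow> real)) \<Rightarrow>
   ('m, 'n) chart \<Rightarrow> 'm \<Rightarrow> (real^'n) set" where
  "leaf_tangent_space A P c x = {v. \<exists>f. smooth_fun A f \<and> (\<forall>g. smooth_fun A g \<longrightarrow>
     frechet_derivative (g \<circ> chart_inv c) (at (chart_map c x)) v = P g f x)}"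

definition leaves_codim_ge_1 ::
  "('m, 'n::finite) chart set \<Rightarrow> (('m \<Rightarrow> real) \<Rightarrow> ('m \<Rightarrow> real) \<Rightarrow> ('m \<Rightarrow> real)) \<Rightarrow> bool" where
  "leaves_codim_ge_1 A P \<longleftrightarrow>
     (\<forall>c\<in>A. \<forall>x\<in>chart_dom c. dim (leaf_tangent_space A P c x) + 1 \<le> CARD('n))"

definition casimir ::
  "('m::topological_space, 'n::finite) chart set \<Rightarrow> (('m \<Rightarrow> real) \<Rightarrow> ('m \<Rightarrow> real) \<Rightarrow> ('m \<Rightarrow> real)) \<Rightarrow>
   ('m \<Rightarrow> real) \<Rightarrow> bool" where
  "casimir A P l \<longleftrightarrow> (\<forall>x. \<forall>y\<in>symplectic_leaf A P x. l y = l x)"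

definition ham_flow ::
  "('m::topological_space, 'n::finite) chart set \<Rightarrow> (('m \<Rightarrow> real) \<Rightarrow> ('m \<Rightarrow> real) \<Rightarrow> ('m \<Rightarrow> real)) \<Rightarrow>
   ('m \<Rightarrow> real) \<Rightarrow> (real \<Rightarrow> 'm \<Rightarrow> 'm) \<Rightarrow> bool" where
  "ham_flow A P f \<Phi> \<longleftrightarrow>
     \<Phi> 0 = id \<and> (\<forall>s t. \<Phi> (s + t) = \<Phi> s \<circ> \<Phi> t) \<and>
     continuous_on UNIV (\<lambda>(t, x). \<Phi> t x) \<and>
     (\<forall>c\<in>A. \<forall>d\<in>A. smooth_on {(t, u). u \<in> chart_image c \<and> \<Phi> t (chart_inv c u) \<in> chart_dom d}
        (\<lambda>(t, u). chart_map d (\<Phi> t (chart_inv c u)))) \<and>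
     (\<forall>x. ham_integral_curve A P f UNIV (\<lambda>t. \<Phi> t x))"

text \<open>The generated group: \<open>\<Phi> (- t)\<close> is the inverse of \<open>\<Phi> t\<close>, so no rule for inverses is needed.\<close>

inductive_set ham_group ::
  "('m::topological_space, 'n::finite) chart set \<Rightarrow> (('m \<Rightarrow> real) \<Rightarrow> ('m \<Rightarrow> real) \<Rightarrow> ('m \<Rightarrow> real)) \<Rightarrow>
   ('m \<Rightarrow> 'm) set"
  for A P where
  id: "id \<in> ham_group A P"
| flow: "\<phi> \<in> ham_group A P \<Longrightarrow> smooth_fun A f \<Longrightarrow> ham_flow A P f \<Phi> \<Longrightarrow> \<Phi> t \<circ> \<phi> \<in> ham_group A P"


section \<open>Volume forms\<close>

text \<open>
  A top-degree form \<open>\<omega>\<close> is given by its coefficients: on \<open>chart_dom c\<close> it is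
  \<open>\<omega> c dx\<^sub>1 \<and> \<dots> \<and> dx\<^sub>n\<close> in the coordinates of \<open>c\<close>.  Coefficients are \<open>0\<close> where they have no meaning,
  so that equal forms are equal as functions.
\<close>

type_synonym ('m, 'n) form = "('m, 'n) chart \<Rightarrow> 'm \<Rightarrow> real"

definition top_form :: "('m, 'n::finite) chart set \<Rightarrow> ('m, 'n) form \<Rightarrow> bool" where
  "top_form A \<omega> \<longleftrightarrow>
     (\<forall>c x. \<not> (c \<in> A \<and> x \<in> chart_dom c) \<longrightarrow> \<omega> c x = 0) \<and>
     (\<forall>c\<in>A. smooth_on (chart_image c) (\<omega> c \<circ> chart_inv c)) \<and>
     (\<forall>c\<in>A. \<forall>d\<in>A. \<forall>x\<in>chart_dom c \<inter> chart_dom d.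
        \<omega> c x = jacobian_det (coord_change c d) (chart_map c x) * \<omega> d x)"

definition volume_form :: "('m, 'n::finite) chart set \<Rightarrow> ('m, 'n) form \<Rightarrow> bool" where
  "volume_form A \<nu> \<longleftrightarrow> top_form A \<nu> \<and> (\<forall>c\<in>A. \<forall>x\<in>chart_dom c. \<nu> c x > 0)"

text \<open>The Borel measure \<open>|\<nu>|\<close> of a volume form, characterised by its values on subsets of charts.\<close>

definition form_measure ::
  "('m::topological_space, 'n::finite) chart set \<Rightarrow> ('m, 'n) form \<Rightarrow> 'm measure" where
  "form_measure A \<nu> = (THE \<mu>. sets \<mu> = sets borel \<and>
     (\<forall>c\<in>A. \<forall>B\<in>sets borel. B \<subseteq> chart_dom c \<longrightarrow>
        emeasure \<mu> B = (\<integral>\<^sup>+u\<in>chart_map c ` B. ennreal (\<nu> c (chart_inv c u)) \<partial>lborel)))"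

definition linear_functional ::
  "('m::topological_space, 'n::finite) chart set \<Rightarrow> ('m \<Rightarrow> real) \<Rightarrow> ('m, 'n) form \<Rightarrow> real" where
  "linear_functional A f \<nu> = (\<integral>x. f x \<partial>form_measure A \<nu>)"

definition Dens :: "('m::topological_space, 'n::finite) chart set \<Rightarrow> ('m, 'n) form set" where
  "Dens A = {\<nu>. volume_form A \<nu> \<and> linear_functional A (\<lambda>x. 1) \<nu> = 1}"

text \<open>The chart \<open>d\<close> around \<open>\<psi> x\<close> is arbitrary: the value does not depend on it.\<close>

definition form_pullback ::
  "('m, 'n::finite) chart set \<Rightarrow> ('m \<Rightarrow> 'm) \<Rightarrow> ('m, 'n) form \<Rightarrow> ('m, 'n) form" where
  "form_pullback A \<psi> \<omega> = (\<lambda>c x. if c \<in> A \<and> x \<in> chart_dom c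
     then (let d = (SOME d. d \<in> A \<and> \<psi> x \<in> chart_dom d) in
       jacobian_det (chart_map d \<circ> \<psi> \<circ> chart_inv c) (chart_map c x) * \<omega> d (\<psi> x))
     else 0)"

definition form_pushforward ::
  "('m, 'n::finite) chart set \<Rightarrow> ('m \<Rightarrow> 'm) \<Rightarrow> ('m, 'n) form \<Rightarrow> ('m, 'n) form" where
  "form_pushforward A \<phi> \<omega> = form_pullback A (inv \<phi>) \<omega>"


section \<open>The Poisson geometry of the space of densities\<close>

text \<open>
  The symplectic leaves of the bracket with \<open>{F\<^sub>f, F\<^sub>g} = F\<^sub>h\<close>, \<open>h = {f, g}\<close>, for the functionals
  \<open>F\<^sub>f = linear_functional A f\<close>: they are the orbits of the group of Hamiltonian diffeomorphisms.
\<close>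

definition dens_leaf ::
  "('m::topological_space, 'n::finite) chart set \<Rightarrow> (('m \<Rightarrow> real) \<Rightarrow> ('m \<Rightarrow> real) \<Rightarrow> ('m \<Rightarrow> real)) \<Rightarrow>
   ('m, 'n) form \<Rightarrow> ('m, 'n) form set" where
  "dens_leaf A P \<nu> = (\<lambda>\<phi>. form_pushforward A \<phi> \<nu>) ` ham_group A P"

definition dens_casimir ::
  "('m::topological_space, 'n::finite) chart set \<Rightarrow> (('m \<Rightarrow> real) \<Rightarrow> ('m \<Rightarrow> real) \<Rightarrow> ('m \<Rightarrow> real)) \<Rightarrow>
   (('m, 'n) form \<Rightarrow> real) \<Rightarrow> bool" where
  "dens_casimir A P C \<longleftrightarrow> (\<forall>\<nu>\<in>Dens A. \<forall>\<mu>\<in>dens_leaf A P \<nu>. C \<mu> = C \<nu>)"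

text \<open>
  On a compact manifold \<open>Dens\<close> is open in an affine subspace of the space of top-degree forms, so its
  tangent vectors at \<open>\<nu>\<close> (the forms of total integral \<open>0\<close>) are the directions in which one can move
  along a straight line inside \<open>Dens\<close>.
\<close>

definition form_line :: "('m, 'n) form \<Rightarrow> ('m, 'n) form \<Rightarrow> real \<Rightarrow> ('m, 'n) form" where
  "form_line \<nu> \<delta> t = (\<lambda>c x. \<nu> c x + t * \<delta> c x)"

definition dens_tangent ::
  "('m::topological_space, 'n::finite) chart set \<Rightarrow> ('m, 'n) form \<Rightarrow> ('m, 'n) form set" where
  "dens_tangent A \<nu> = {\<delta>. top_form A \<delta> \<and> (\<forall>\<^sub>F t in nhds 0. form_line \<nu> \<delta> t \<in> Dens A)}"

definition has_dens_differential ::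
  "('m::topological_space, 'n::finite) chart set \<Rightarrow> (('m, 'n) form \<Rightarrow> real) \<Rightarrow>
   ('m, 'n) form \<Rightarrow> (('m, 'n) form \<Rightarrow> real) \<Rightarrow> bool" where
  "has_dens_differential A C \<nu> D \<longleftrightarrow>
     (\<forall>\<delta>\<in>dens_tangent A \<nu>. ((\<lambda>t. C (form_line \<nu> \<delta> t)) has_real_derivative D \<delta>) (at 0)) \<and>
     (\<forall>\<delta>\<in>dens_tangent A \<nu>. \<forall>\<epsilon>\<in>dens_tangent A \<nu>. \<forall>a b.
        D (\<lambda>c x. a * \<delta> c x + b * \<epsilon> c x) = a * D \<delta> + b * D \<epsilon>)"

text \<open>
  Functional independence of a sequence: at every point the differentials exist and those of any
  finitely many members are linearly independent.
\<close>

definition functionally_independent ::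
  "('m::topological_space, 'n::finite) chart set \<Rightarrow> (nat \<Rightarrow> ('m, 'n) form \<Rightarrow> real) \<Rightarrow> bool" where
  "functionally_independent A C \<longleftrightarrow> (\<forall>\<nu>\<in>Dens A. \<exists>D.
     (\<forall>i. has_dens_differential A (C i) \<nu> (D i)) \<and>
     (\<forall>N a. (\<forall>\<delta>\<in>dens_tangent A \<nu>. (\<Sum>i<N. a i * D i \<delta>) = 0) \<longrightarrow> (\<forall>i<N. a i = 0)))"

definition casimir_functional ::
  "('m::topological_space, 'n::finite) chart set \<Rightarrow> (real \<Rightarrow> real) \<Rightarrow> ('m \<Rightarrow> real) \<Rightarrow>
   ('m, 'n) form \<Rightarrow> real" where
  "casimir_functional A h l = linear_functional A (h \<circ> l)"

end

(*
  A Hamiltonian diffeomorphism \<phi> is a composition of flows.  It preserves the orientation, so by the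
  change of variables formula the measure of the push-forward of \<nu> is the image of the measure of \<nu>
  under \<phi>.  As \<lambda> \<circ> \<phi> = \<lambda>, the integral of h \<circ> \<lambda> is invariant, whatever h is.

  For the independence take h = y^(i+1).  The differential at \<nu> of the functional given by g sends the
  tangent vector \<rho>\<nu> to the integral of g\<rho> against \<nu>.  If a combination g of powers of \<lambda> has zero
  differential, then the tangent vector (g - m)\<nu>, m the mean of g, shows that the integral of (g - m)^2
  vanishes, so g is constant.  But \<lambda> takes infinitely many values, M being connected, and a
  polynomial without constant term that is constant on an infinite set is zero.
*)
theory Submission
  imports Defs
begin

text \<open>The coefficients of a form transform by the signed Jacobian, whereas measures transform
  by its absolute value; this is why flows must be shown to preserve the orientation before their
  push-forwards can be read as image measures. \<open>form_measure\<close> is moreover a definite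
  description, so existence and uniqueness have to be settled. Existence amounts to consistency
  between charts, which is the change of variables formula for the identity map: hence one such
  formula for maps \<open>\<psi>\<close>, used with \<open>id\<close> for existence and with
  \<open>inv \<phi>\<close> for the push-forward. Integrals are globalised by a finite disjoint
  Borel cover subordinate to charts; indicators do the work of a partition of unity, as only
  measurability matters. The powers start with exponent 1 because exponent 0 gives the total mass,
  which is constant on \<open>Dens\<close> and has zero differential there. For the same reason the
  differential detects the function \<open>g\<close> only up to a constant.\<close>

section \<open>Change of variables for non-negative integrals\<close>

text \<open>A bridge from absolute integrability and \<open>integral\<close>, the language of the
  change of variables theorem, to non-negative integrals, the language of measures. Measurability
  refers to \<open>lebesgue\<close>, where it is available for Jacobians;
  \<open>nn_integral_completion\<close> carries the integral over to \<open>lborel\<close>.\<close>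

lemma set_nn_integral_eq_integral_lebesgue:
  fixes f :: "'a::euclidean_space \<Rightarrow> real"
  assumes f: "\<And>x. x \<in> S \<Longrightarrow> 0 \<le> f x"
    and m: "(\<lambda>x. f x * indicator S x) \<in> borel_measurable lebesgue"
  shows "f absolutely_integrable_on S \<longleftrightarrow> (\<integral>\<^sup>+x\<in>S. ennreal (f x) \<partial>lborel) < \<infinity>" (is ?A)
    and "f absolutely_integrable_on S \<Longrightarrow>
      (\<integral>\<^sup>+x\<in>S. ennreal (f x) \<partial>lborel) = ennreal (integral S f)"
proof -
  have m': "(\<lambda>x. indicator S x * f x) \<in> borel_measurable lebesgue"
    using m by (simp add: mult.commute)
  have "(\<integral>\<^sup>+x. ennreal (norm (indicator S x *\<^sub>R f x)) \<partial>lebesgue) = (\<integral>\<^sup>+x\<in>S. ennreal (f x) \<partial>lborel)"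
    unfolding nn_integral_completion
    by (intro nn_integral_cong) (auto simp: indicator_def f)
  then show ?A
    unfolding set_integrable_def integrable_iff_bounded using m' by simp
  assume "f absolutely_integrable_on S"
  then have "(f has_integral integral S f) S"
    using set_lebesgue_integral_eq_integral(1) integrable_integral by blast
  from nn_integral_has_integral_lebesgue'[OF f this]
  show "(\<integral>\<^sup>+x\<in>S. ennreal (f x) \<partial>lborel) = ennreal (integral S f)" by simp
qed

text \<open>\<open>f\<close> is Borel so that its composite with the continuous map \<open>g\<close>
  is measurable: the preimage of a Lebesgue measurable set under a continuous map can fail to be
  one.\<close>

lemma change_of_variables_integrand_measurable:
  fixes g :: "real^'n::{finite,wellorder} \<Rightarrow> real^'n::_" and f :: "real^'n::_ \<Rightarrow> real"
  assumes S: "S \<in> sets lebesgue"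
    and g: "\<And>x. x \<in> S \<Longrightarrow> (g has_derivative g' x) (at x within S)"
    and f: "f \<in> borel_measurable borel"
  shows "(\<lambda>x. \<bar>det (matrix (g' x))\<bar> * f (g x) * indicator S x) \<in> borel_measurable lebesgue"
proof -
  have "continuous_on S g"
    by (meson g has_derivative_continuous_on)
  then have "g \<in> borel_measurable (lebesgue_on S)"
    using S by (rule continuous_imp_measurable_on_sets_lebesgue)
  then have "(\<lambda>x. f (g x)) \<in> borel_measurable (lebesgue_on S)"
    using f by (rule measurable_compose)
  moreover have "(\<lambda>x. det (matrix (g' x))) \<in> borel_measurable (lebesgue_on S)"
    using S g by (rule borel_measurable_det_Jacobian)
  ultimately have "(\<lambda>x. \<bar>det (matrix (g' x))\<bar> * f (g x)) \<in> borel_measurable (lebesgue_on S)"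
    by measurable
  then have "(\<lambda>x. indicator S x *\<^sub>R (\<bar>det (matrix (g' x))\<bar> * f (g x))) \<in> borel_measurable lebesgue"
    using S by (subst (asm) borel_measurable_restrict_space_iff) (auto simp: mult.commute)
  then show ?thesis
    by (simp add: mult.commute)
qed

text \<open>Integrability of one side is equivalent to that of the other, so the two sides are
  infinite together and the formula also holds in that case.\<close>

lemma nn_integral_change_of_variables:
  fixes g :: "real^'n::{finite,wellorder} \<Rightarrow> real^'n::_" and f :: "real^'n::_ \<Rightarrow> real"
  assumes S: "S \<in> sets lebesgue"
    and g: "\<And>x. x \<in> S \<Longrightarrow> (g has_derivative g' x) (at x within S)"
    and inj: "inj_on g S"
    and f: "f \<in> borel_measurable borel" "\<And>x. 0 \<le> f x"
    and gS: "g ` S \<in> sets borel"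
  shows "(\<integral>\<^sup>+x\<in>g ` S. ennreal (f x) \<partial>lborel) =
    (\<integral>\<^sup>+x\<in>S. ennreal (\<bar>det (matrix (g' x))\<bar> * f (g x)) \<partial>lborel)"
proof -
  let ?h = "\<lambda>x. \<bar>det (matrix (g' x))\<bar> * f (g x)"
  have m1: "(\<lambda>x. f x * indicator (g ` S) x) \<in> borel_measurable lebesgue"
    using f gS by (intro measurable_completion) auto
  have m2: "(\<lambda>x. ?h x * indicator S x) \<in> borel_measurable lebesgue"
    by (rule change_of_variables_integrand_measurable[OF S g f(1)])
  \<comment> \<open>A free value \<open>b\<close> lets the equivalence transport both integrability
    and the integral; the detour over \<open>real^1\<close> fits the vector-valued change of
    variables theorem.\<close>
  have *: "?h absolutely_integrable_on S \<and> integral S ?h = b \<longleftrightarrow>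
      f absolutely_integrable_on (g ` S) \<and> integral (g ` S) f = b" for b
    using has_absolute_integral_change_of_variables[OF S g inj, of "\<lambda>x. vec (f x) :: real^1" "vec b"]
    unfolding absolutely_integrable_on_1_iff integral_on_1_eq by (simp add: vec_eq_iff)
  have h: "0 \<le> ?h x" for x using f by simp
  note 1 = set_nn_integral_eq_integral_lebesgue[of "g ` S" f, OF f(2) m1]
  note 2 = set_nn_integral_eq_integral_lebesgue[of S ?h, OF h m2]
  show ?thesis
  proof (cases "f absolutely_integrable_on (g ` S)")
    case True
    have **: "?h absolutely_integrable_on S \<and> integral S ?h = integral (g ` S) f"
      using True *[of "integral (g ` S) f"] by blast
    show ?thesis
      unfolding 1(2)[OF True] 2(2)[OF conjunct1[OF **]] conjunct2[OF **] ..
  next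
    case False
    then have "\<not> ?h absolutely_integrable_on S" using * by blast
    with False show ?thesis unfolding 1(1) 2(1) by (simp only: infinity_ennreal_def less_top[symmetric]) simp
  qed
qed

section \<open>Charts and the measure of a form\<close>

lemma is_chartD:
  assumes "is_chart c"
  shows "open (chart_dom c)" "open (chart_image c)"
    "x \<in> chart_dom c \<Longrightarrow> chart_inv c (chart_map c x) = x"
    "u \<in> chart_image c \<Longrightarrow> chart_map c (chart_inv c u) = u"
    "u \<in> chart_image c \<Longrightarrow> chart_inv c u \<in> chart_dom c"
    "continuous_on (chart_dom c) (chart_map c)" "continuous_on (chart_image c) (chart_inv c)"
  using assms unfolding is_chart_def homeomorphism_def by blast+

lemma chart_image_subset_eq:
  assumes "is_chart c" "B \<subseteq> chart_dom c"
  shows "chart_map c ` B = {u \<in> chart_image c. chart_inv c u \<in> B}"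
  using is_chartD[OF assms(1)] assms(2) by (auto simp: image_iff)

lemma open_chart_map_image:
  assumes c: "is_chart c" and B: "open B" "B \<subseteq> chart_dom c"
  shows "open (chart_map c ` B)"
proof -
  have "open (chart_inv c -` B \<inter> chart_image c)"
    using is_chartD[OF c] B(1) by (metis continuous_on_open_vimage)
  moreover have "chart_map c ` B = chart_inv c -` B \<inter> chart_image c"
    using chart_image_subset_eq[OF c B(2)] by auto
  ultimately show ?thesis by simp
qed

lemma chart_inv_borel [measurable]:
  assumes c: "is_chart c"
  shows "chart_inv c \<in> borel \<rightarrow>\<^sub>M (borel :: 'm::topological_space measure)"
proof (rule borel_measurableI)
  fix S :: "'m set" assume S: "open S"
  \<comment> \<open>Outside the chart image \<open>inv_into\<close> chooses from the empty
    predicate, hence always takes this one value.\<close>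
  define k where "k = (SOME y :: 'm. False)"
  have k: "chart_inv c u = k" if "u \<notin> chart_image c" for u
  proof -
    have "(\<lambda>y. y \<in> chart_dom c \<and> chart_map c y = u) = (\<lambda>y. False)" using that by blast
    then show ?thesis unfolding chart_inv_def inv_into_def k_def by simp
  qed
  have 1: "open (chart_inv c -` S \<inter> chart_image c)"
    using is_chartD[OF c] S by (metis continuous_on_open_vimage)
  have 2: "chart_inv c -` S \<inter> space borel =
      (chart_inv c -` S \<inter> chart_image c) \<union> (if k \<in> S then - chart_image c else {})"
    using k by auto
  have 3: "(if k \<in> S then - chart_image c else {}) \<in> sets borel"
    using is_chartD(2)[OF c] by simp
  show "chart_inv c -` S \<inter> space borel \<in> sets borel"
    unfolding 2 by (rule sets.Un[OF borel_open[OF 1] 3])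
qed

text \<open>Continuous images of Borel sets need not be Borel, but this one is a preimage under
  \<open>chart_inv c\<close>, cut down to the open chart image.\<close>

lemma chart_map_image_borel:
  assumes c: "is_chart c" and B: "B \<in> sets borel" "B \<subseteq> chart_dom c"
  shows "chart_map c ` B \<in> sets borel"
proof -
  have "chart_map c ` B = (chart_inv c -` B \<inter> space borel) \<inter> chart_image c"
    using chart_image_subset_eq[OF c B(2)] by auto
  then show ?thesis
    using measurable_sets[OF chart_inv_borel[OF c] B(1)] is_chartD(2)[OF c] by auto
qed

text \<open>The predicate under the definite description in \<open>form_measure\<close>, named so
  that existence and uniqueness can be treated apart.\<close>

definition represents ::
  "('m::topological_space, 'n::finite) chart set \<Rightarrow> ('m, 'n) form \<Rightarrow> 'm measure \<Rightarrow> bool" where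
  "represents A \<nu> \<mu> \<longleftrightarrow> sets \<mu> = sets borel \<and>
     (\<forall>c\<in>A. \<forall>B\<in>sets borel. B \<subseteq> chart_dom c \<longrightarrow>
        emeasure \<mu> B = (\<integral>\<^sup>+u\<in>chart_map c ` B. ennreal (\<nu> c (chart_inv c u)) \<partial>lborel))"

text \<open>The cut-off keeps the arbitrary values of \<open>chart_inv\<close> outside the chart
  image out of the integrals and makes the coefficient of a volume form non-negative
  everywhere.\<close>

definition chart_density :: "('m, 'n::finite) chart \<Rightarrow> ('m, 'n) form \<Rightarrow> real^'n \<Rightarrow> real" where
  "chart_density c \<nu> = (\<lambda>u. \<nu> c (chart_inv c u) * indicator (chart_image c) u)"

definition chart_measure :: "('m::topological_space, 'n::finite) chart \<Rightarrow> ('m, 'n) form \<Rightarrow> 'm measure" where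
  "chart_measure c \<nu> = distr (density lborel (\<lambda>u. ennreal (chart_density c \<nu> u))) borel (chart_inv c)"

lemma top_form_continuous:
  assumes "top_form A \<nu>" "c \<in> A"
  shows "continuous_on (chart_image c) (\<nu> c \<circ> chart_inv c)"
proof -
  have "Ck_on 0 (chart_image c) (\<nu> c \<circ> chart_inv c)"
    using assms unfolding top_form_def smooth_on_def by blast
  then show ?thesis by simp
qed

lemma chart_density_measurable:
  assumes "is_chart c" "top_form A \<nu>" "c \<in> A"
  shows "chart_density c \<nu> \<in> borel_measurable borel"
proof -
  have "(\<lambda>u. indicator (chart_image c) u *\<^sub>R (\<nu> c \<circ> chart_inv c) u) \<in> borel_measurable borel"
    using is_chartD(2)[OF assms(1)] top_form_continuous[OF assms(2,3)]
    by (intro borel_measurable_continuous_on_indicator) auto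
  then show ?thesis unfolding chart_density_def by (simp add: mult.commute)
qed

lemma set_nn_integral_chart_density:
  assumes c: "is_chart c" and S: "S \<subseteq> chart_image c"
  shows "(\<integral>\<^sup>+u\<in>S. ennreal (chart_density c \<nu> u) \<partial>lborel) =
    (\<integral>\<^sup>+u\<in>S. ennreal (\<nu> c (chart_inv c u)) \<partial>lborel)"
  using S by (intro nn_integral_cong) (auto simp: chart_density_def indicator_def)

lemma emeasure_chart_measure:
  assumes c: "is_chart c" "top_form A \<nu>" "c \<in> A"
    and B: "B \<in> sets borel" "B \<subseteq> chart_dom c"
  shows "emeasure (chart_measure c \<nu>) B = (\<integral>\<^sup>+u\<in>chart_map c ` B. ennreal (\<nu> c (chart_inv c u)) \<partial>lborel)"
proof -
  note [measurable] = chart_inv_borel[OF c(1)] chart_density_measurable[OF c]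
  have "chart_inv c -` B \<in> sets borel"
    using measurable_sets[OF chart_inv_borel[OF c(1)] B(1)] by simp
  then have "emeasure (chart_measure c \<nu>) B =
      (\<integral>\<^sup>+u\<in>chart_inv c -` B. ennreal (chart_density c \<nu> u) \<partial>lborel)"
    using B(1) unfolding chart_measure_def
    by (subst emeasure_distr) (auto simp: emeasure_density)
  also have "\<dots> = (\<integral>\<^sup>+u\<in>chart_map c ` B. ennreal (\<nu> c (chart_inv c u)) \<partial>lborel)"
    unfolding chart_image_subset_eq[OF c(1) B(2)]
    by (intro nn_integral_cong) (auto simp: chart_density_def indicator_def)
  finally show ?thesis .
qed

section \<open>Orientation preserving maps\<close>

lemma smooth_on_differentiable:
  assumes "smooth_on S f" "x \<in> S"
  shows "f differentiable (at x)"
proof -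
  have "Ck_on (Suc 0) S f" using assms(1) unfolding smooth_on_def by blast
  then show ?thesis using assms(2) by simp
qed

lemma jacobian_det_compose:
  fixes f g :: "real^'n \<Rightarrow> real^'n"
  assumes "g differentiable (at x)" "f differentiable (at (g x))"
  shows "jacobian_det (f \<circ> g) x = jacobian_det f (g x) * jacobian_det g x"
  unfolding jacobian_det_def frechet_derivative_compose[OF assms]
  by (simp add: matrix_compose linear_frechet_derivative assms det_mul)

lemma jacobian_det_cong_open:
  assumes "f differentiable (at x)" "open X" "x \<in> X" "\<And>y. y \<in> X \<Longrightarrow> f y = g y"
  shows "jacobian_det g x = jacobian_det f x"
  unfolding jacobian_det_def using frechet_derivative_transform_within_open[OF assms] by simp

definition chart_rep ::
  "('m, 'n) chart \<Rightarrow> ('m, 'n) chart \<Rightarrow> ('m \<Rightarrow> 'm) \<Rightarrow> real^'n \<Rightarrow> real^'n" where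
  "chart_rep c d \<psi> = chart_map d \<circ> \<psi> \<circ> chart_inv c"

text \<open>Pointwise differentiability is the regularity with which the chain rule and the change
  of variables theorem operate.\<close>

definition chart_differentiable ::
  "('m::topological_space, 'n::finite) chart set \<Rightarrow> ('m \<Rightarrow> 'm) \<Rightarrow> bool" where
  "chart_differentiable A \<psi> \<longleftrightarrow> continuous_on UNIV \<psi> \<and>
     (\<forall>c\<in>A. \<forall>d\<in>A. \<forall>x\<in>chart_dom c. \<psi> x \<in> chart_dom d \<longrightarrow>
        chart_rep c d \<psi> differentiable (at (chart_map c x)))"

text \<open>A positive Jacobian identifies the signed factor in \<open>form_pullback\<close> with
  the absolute value in the change of variables formula.\<close>

definition orientation_preserving ::
  "('m::topological_space, 'n::finite) chart set \<Rightarrow> ('m \<Rightarrow> 'm) \<Rightarrow> bool" where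
  "orientation_preserving A \<psi> \<longleftrightarrow> chart_differentiable A \<psi> \<and>
     (\<forall>c\<in>A. \<forall>d\<in>A. \<forall>x\<in>chart_dom c. \<psi> x \<in> chart_dom d \<longrightarrow>
        jacobian_det (chart_rep c d \<psi>) (chart_map c x) > 0)"

lemma chart_differentiableD:
  assumes "chart_differentiable A \<psi>"
  shows "continuous_on UNIV \<psi>"
    and "c \<in> A \<Longrightarrow> d \<in> A \<Longrightarrow> x \<in> chart_dom c \<Longrightarrow> \<psi> x \<in> chart_dom d \<Longrightarrow>
      chart_rep c d \<psi> differentiable (at (chart_map c x))"
  using assms unfolding chart_differentiable_def by blast+

lemma orientation_preservingD:
  assumes "orientation_preserving A \<psi>"
  shows "chart_differentiable A \<psi>"
    and "c \<in> A \<Longrightarrow> d \<in> A \<Longrightarrow> x \<in> chart_dom c \<Longrightarrow> \<psi> x \<in> chart_dom d \<Longrightarrow>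
      jacobian_det (chart_rep c d \<psi>) (chart_map c x) > 0"
  using assms unfolding orientation_preserving_def by blast+

lemma chart_rep_id: "chart_rep c d id = coord_change c d"
  unfolding chart_rep_def coord_change_def by simp

locale compact_oriented =
  fixes A :: "('m::t2_space, 'n::{finite,wellorder}) chart set"
  assumes compact_oriented: "compact_oriented_manifold A"
begin

lemma chart: "c \<in> A \<Longrightarrow> is_chart c"
  using compact_oriented unfolding compact_oriented_manifold_def oriented_atlas_def smooth_atlas_def
  by blast

lemma chart_at: obtains c where "c \<in> A" "x \<in> chart_dom c"
  using compact_oriented unfolding compact_oriented_manifold_def oriented_atlas_def smooth_atlas_def
  by blast

text \<open>The chart representations of \<open>id\<close> are the coordinate changes, so this
  restates the compatibility and orientation of the atlas. It allows a change of chart to be treated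
  as composition with \<open>id\<close>.\<close>

lemma orientation_preserving_id: "orientation_preserving A id"
  unfolding orientation_preserving_def chart_differentiable_def chart_rep_id
proof (intro conjI ballI impI)
  fix c d x assume *: "c \<in> A" "d \<in> A" "x \<in> chart_dom c" "id x \<in> chart_dom d"
  then have x: "x \<in> chart_dom c \<inter> chart_dom d" by simp
  have "smooth_on (chart_map c ` (chart_dom c \<inter> chart_dom d)) (coord_change c d)"
    using compact_oriented * unfolding compact_oriented_manifold_def oriented_atlas_def smooth_atlas_def
    by blast
  then show "coord_change c d differentiable (at (chart_map c x))"
    using x by (intro smooth_on_differentiable) auto
  show "0 < jacobian_det (coord_change c d) (chart_map c x)"
    using compact_oriented * x unfolding compact_oriented_manifold_def oriented_atlas_def by blast
qed (simp add: id_def)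

lemma open_chart_preimage:
  assumes "c \<in> A" "d \<in> A" "continuous_on UNIV \<psi>"
  shows "open {u \<in> chart_image c. \<psi> (chart_inv c u) \<in> chart_dom d}"
proof -
  note c = is_chartD[OF chart[OF assms(1)]] and d = is_chartD[OF chart[OF assms(2)]]
  have "continuous_on (chart_image c) (\<lambda>u. \<psi> (chart_inv c u))"
    by (rule continuous_on_compose2[OF assms(3) c(7)]) auto
  then have "open ((\<lambda>u. \<psi> (chart_inv c u)) -` chart_dom d \<inter> chart_image c)"
    using continuous_on_open_vimage[OF c(2)] d(1) by blast
  moreover have "(\<lambda>u. \<psi> (chart_inv c u)) -` chart_dom d \<inter> chart_image c =
      {u \<in> chart_image c. \<psi> (chart_inv c u) \<in> chart_dom d}" by auto
  ultimately show ?thesis by simp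
qed

lemma chart_rep_compose:
  assumes \<psi>: "chart_differentiable A \<psi>" and \<theta>: "chart_differentiable A \<theta>"
    and A: "c \<in> A" "d \<in> A" "e \<in> A"
    and x: "x \<in> chart_dom c" "\<psi> x \<in> chart_dom d" "\<theta> (\<psi> x) \<in> chart_dom e"
  shows "chart_rep c e (\<theta> \<circ> \<psi>) differentiable (at (chart_map c x))"
    and "jacobian_det (chart_rep c e (\<theta> \<circ> \<psi>)) (chart_map c x) =
      jacobian_det (chart_rep d e \<theta>) (chart_map d (\<psi> x)) * jacobian_det (chart_rep c d \<psi>) (chart_map c x)"
proof -
  note c = is_chartD[OF chart[OF A(1)]] and d = is_chartD[OF chart[OF A(2)]]
  let ?u = "chart_map c x" and ?f = "chart_rep c d \<psi>" and ?g = "chart_rep d e \<theta>"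
  \<comment> \<open>The open set on which the intermediate chart \<open>d\<close> can be inserted;
    elsewhere \<open>chart_map d\<close> has no meaning.\<close>
  let ?X = "{u \<in> chart_image c. \<psi> (chart_inv c u) \<in> chart_dom d}"
  have f: "?f differentiable (at ?u)"
    by (rule chart_differentiableD(2)[OF \<psi> A(1,2) x(1,2)])
  have fu: "?f ?u = chart_map d (\<psi> x)"
    using c(3) x unfolding chart_rep_def by simp
  have g: "?g differentiable (at (?f ?u))"
    unfolding fu by (rule chart_differentiableD(2)[OF \<theta> A(2,3) x(2,3)])
  have gf: "(?g \<circ> ?f) differentiable (at ?u)"
    by (rule differentiable_chain_at[OF f g])
  have X: "open ?X" "?u \<in> ?X"
    using open_chart_preimage[OF A(1,2) chart_differentiableD(1)[OF \<psi>]] c(3) x by auto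
  have eq: "(?g \<circ> ?f) u = chart_rep c e (\<theta> \<circ> \<psi>) u" if "u \<in> ?X" for u
    using that d(3) unfolding chart_rep_def by simp
  show "chart_rep c e (\<theta> \<circ> \<psi>) differentiable (at ?u)"
    by (rule differentiableI[OF has_derivative_transform_within_open[OF
          gf[unfolded frechet_derivative_works] X eq]])
  show "jacobian_det (chart_rep c e (\<theta> \<circ> \<psi>)) ?u =
      jacobian_det ?g (chart_map d (\<psi> x)) * jacobian_det ?f ?u"
    by (simp only: jacobian_det_cong_open[OF gf X eq] jacobian_det_compose[OF f g] fu)
qed

lemma orientation_preserving_compose:
  assumes \<psi>: "orientation_preserving A \<psi>" and \<theta>: "orientation_preserving A \<theta>"
  shows "orientation_preserving A (\<theta> \<circ> \<psi>)"
  unfolding orientation_preserving_def chart_differentiable_def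
proof (intro conjI ballI impI)
  note diff = \<psi>[THEN orientation_preservingD(1)] \<theta>[THEN orientation_preservingD(1)]
  show "continuous_on UNIV (\<theta> \<circ> \<psi>)"
    using diff[THEN chart_differentiableD(1)]
    by (metis continuous_on_compose continuous_on_subset subset_UNIV)
  fix c e x assume *: "c \<in> A" "e \<in> A" "x \<in> chart_dom c" "(\<theta> \<circ> \<psi>) x \<in> chart_dom e"
  then have x: "\<theta> (\<psi> x) \<in> chart_dom e" by simp
  obtain d where d: "d \<in> A" "\<psi> x \<in> chart_dom d" by (rule chart_at)
  note comp = chart_rep_compose[OF diff *(1) d(1) *(2,3) d(2) x]
  show "chart_rep c e (\<theta> \<circ> \<psi>) differentiable (at (chart_map c x))"
    by (rule comp(1))
  show "jacobian_det (chart_rep c e (\<theta> \<circ> \<psi>)) (chart_map c x) > 0"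
    unfolding comp(2)
    by (intro mult_pos_pos orientation_preservingD(2)[OF \<psi>] orientation_preservingD(2)[OF \<theta>] * d x)
qed

text \<open>Replacing \<open>d\<close> by the chosen chart \<open>e\<close> multiplies the Jacobian
  of \<open>\<psi>\<close> by that of the coordinate change, by the chain rule for
  \<open>id \<circ> \<psi>\<close>. The transformation law of \<open>\<omega>\<close> absorbs
  exactly this factor, so the choice by \<open>SOME\<close> is immaterial.\<close>

lemma form_pullback_eq:
  assumes \<psi>: "orientation_preserving A \<psi>" and \<omega>: "top_form A \<omega>"
    and A: "c \<in> A" "d \<in> A" and x: "x \<in> chart_dom c" "\<psi> x \<in> chart_dom d"
  shows "form_pullback A \<psi> \<omega> c x = jacobian_det (chart_rep c d \<psi>) (chart_map c x) * \<omega> d (\<psi> x)"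
proof -
  define e where "e = (SOME d. d \<in> A \<and> \<psi> x \<in> chart_dom d)"
  have e: "e \<in> A" "\<psi> x \<in> chart_dom e"
    using someI[of "\<lambda>d. d \<in> A \<and> \<psi> x \<in> chart_dom d" d] A x unfolding e_def by auto
  have "jacobian_det (chart_rep c e \<psi>) (chart_map c x) =
      jacobian_det (coord_change d e) (chart_map d (\<psi> x)) * jacobian_det (chart_rep c d \<psi>) (chart_map c x)"
    using chart_rep_compose(2)[OF \<psi>[THEN orientation_preservingD(1)]
        orientation_preserving_id[THEN orientation_preservingD(1)] A e(1) x] e(2)
    by (simp add: chart_rep_id)
  moreover have "\<omega> d (\<psi> x) = jacobian_det (coord_change d e) (chart_map d (\<psi> x)) * \<omega> e (\<psi> x)"
    using \<omega> A e x unfolding top_form_def by blast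
  moreover have "form_pullback A \<psi> \<omega> c x = jacobian_det (chart_rep c e \<psi>) (chart_map c x) * \<omega> e (\<psi> x)"
    unfolding form_pullback_def e_def[symmetric] Let_def chart_rep_def using A x by simp
  ultimately show ?thesis by simp
qed

lemma form_pullback_id:
  assumes "top_form A \<omega>" "c \<in> A" "x \<in> chart_dom c"
  shows "form_pullback A id \<omega> c x = \<omega> c x"
proof -
  have "\<omega> c x = jacobian_det (coord_change c c) (chart_map c x) * \<omega> c x"
    using assms unfolding top_form_def by blast
  then show ?thesis
    using form_pullback_eq[OF orientation_preserving_id assms(1,2,2,3)] assms(3)
    by (simp only: chart_rep_id id_apply)
qed

text \<open>The change of variables formula for a single pair of charts, whence both
  \<open>B\<close> and its image lie in chart domains. The first claim serves to add up such pieces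
  under one integral.\<close>

lemma nn_integral_form_pullback:
  assumes \<psi>: "orientation_preserving A \<psi>" "inj \<psi>" and \<nu>: "volume_form A \<nu>"
    and A: "c \<in> A" "d \<in> A"
    and B: "B \<in> sets borel" "B \<subseteq> chart_dom c" "\<psi> ` B \<in> sets borel" "\<psi> ` B \<subseteq> chart_dom d"
  shows "(\<lambda>u. ennreal (form_pullback A \<psi> \<nu> c (chart_inv c u)) * indicator (chart_map c ` B) u)
      \<in> borel_measurable lebesgue"
    and "(\<integral>\<^sup>+u\<in>chart_map d ` \<psi> ` B. ennreal (\<nu> d (chart_inv d u)) \<partial>lborel) =
      (\<integral>\<^sup>+u\<in>chart_map c ` B. ennreal (form_pullback A \<psi> \<nu> c (chart_inv c u)) \<partial>lborel)"
proof -
  let ?g = "chart_rep c d \<psi>" and ?f = "chart_density d \<nu>" and ?S = "chart_map c ` B"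
  let ?g' = "\<lambda>u. frechet_derivative ?g (at u)"
  note c = is_chartD[OF chart[OF A(1)]] and d = is_chartD[OF chart[OF A(2)]]
  have top: "top_form A \<nu>" and pos: "\<And>x. x \<in> chart_dom d \<Longrightarrow> \<nu> d x > 0"
    using \<nu> A unfolding volume_form_def by auto
  have S: "?S \<in> sets borel" by (rule chart_map_image_borel[OF chart[OF A(1)] B(1,2)])
  then have S': "?S \<in> sets lebesgue" by auto
  have g: "(?g has_derivative ?g' u) (at u within ?S)" if "u \<in> ?S" for u
  proof -
    obtain x where x: "x \<in> B" "u = chart_map c x" using \<open>u \<in> ?S\<close> by blast
    then have "x \<in> chart_dom c" "\<psi> x \<in> chart_dom d" using B(2,4) by blast+
    then have "?g differentiable (at u)"
      using orientation_preservingD(1)[OF \<psi>(1)] A x(2) chart_differentiableD(2) by blast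
    then show ?thesis
      by (simp add: frechet_derivative_works has_derivative_at_withinI)
  qed
  have gS: "?g ` ?S = chart_map d ` \<psi> ` B"
  proof -
    have "?g (chart_map c x) = chart_map d (\<psi> x)" if "x \<in> B" for x
      using c(3) B(2) that unfolding chart_rep_def by auto
    then show ?thesis by (simp only: image_image cong: image_cong)
  qed
  have inj: "inj_on ?g ?S"
  proof (rule inj_onI)
    fix u v assume "u \<in> ?S" "v \<in> ?S" and eq: "?g u = ?g v"
    then obtain x y where xy: "x \<in> B" "u = chart_map c x" "y \<in> B" "v = chart_map c y" by blast
    then have "chart_map d (\<psi> x) = chart_map d (\<psi> y)"
      using eq c(3) B(2) unfolding chart_rep_def by (auto simp: subset_iff)
    then have "\<psi> x = \<psi> y" using xy B(4) d(3) by (metis image_subset_iff)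
    then show "u = v" using \<psi>(2) xy by (auto dest: injD)
  qed
  have f: "?f \<in> borel_measurable borel" "\<And>u. 0 \<le> ?f u"
    using chart_density_measurable[OF chart[OF A(2)] top A(2)] pos d(5)
    by (auto simp: chart_density_def indicator_def less_imp_le)
  have gS': "?g ` ?S \<in> sets borel"
    unfolding gS by (rule chart_map_image_borel[OF chart[OF A(2)] B(3,4)])
  \<comment> \<open>On these points the Jacobian is positive and the cut-off in \<open>?f\<close> is
    inactive.\<close>
  have eq: "form_pullback A \<psi> \<nu> c (chart_inv c u) = \<bar>det (matrix (?g' u))\<bar> * ?f (?g u)" if "u \<in> ?S" for u
  proof -
    obtain x where x: "x \<in> B" "u = chart_map c x" using \<open>u \<in> ?S\<close> by blast
    then have x': "x \<in> chart_dom c" "\<psi> x \<in> chart_dom d" using B(2,4) by blast+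
    have "jacobian_det ?g u > 0" using orientation_preservingD(2)[OF \<psi>(1) A x'] x by simp
    moreover have "?f (?g u) = \<nu> d (\<psi> x)"
      using x x' c(3) d(3) unfolding chart_density_def chart_rep_def by (auto simp: indicator_def)
    ultimately show ?thesis
      using form_pullback_eq[OF \<psi>(1) top A x'] x c(3) x' unfolding jacobian_det_def by simp
  qed
  have "(\<lambda>u. ennreal (form_pullback A \<psi> \<nu> c (chart_inv c u)) * indicator ?S u) =
      (\<lambda>u. ennreal (\<bar>det (matrix (?g' u))\<bar> * ?f (?g u) * indicator ?S u))"
    using eq by (auto simp: indicator_def fun_eq_iff)
  then show "(\<lambda>u. ennreal (form_pullback A \<psi> \<nu> c (chart_inv c u)) * indicator ?S u)
      \<in> borel_measurable lebesgue"
    using change_of_variables_integrand_measurable[OF S' g f(1)] by simp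
  have "(\<integral>\<^sup>+u\<in>chart_map d ` \<psi> ` B. ennreal (\<nu> d (chart_inv d u)) \<partial>lborel) =
      (\<integral>\<^sup>+u\<in>?g ` ?S. ennreal (?f u) \<partial>lborel)"
    unfolding gS using B(4) by (subst set_nn_integral_chart_density[OF chart[OF A(2)]]) auto
  also have "\<dots> = (\<integral>\<^sup>+u\<in>?S. ennreal (\<bar>det (matrix (?g' u))\<bar> * ?f (?g u)) \<partial>lborel)"
    by (rule nn_integral_change_of_variables[OF S' g inj f gS'])
  also have "\<dots> = (\<integral>\<^sup>+u\<in>?S. ennreal (form_pullback A \<psi> \<nu> c (chart_inv c u)) \<partial>lborel)"
    using eq by (intro nn_integral_cong) (auto simp: indicator_def)
  finally show "(\<integral>\<^sup>+u\<in>chart_map d ` \<psi> ` B. ennreal (\<nu> d (chart_inv d u)) \<partial>lborel) =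
      (\<integral>\<^sup>+u\<in>?S. ennreal (form_pullback A \<psi> \<nu> c (chart_inv c u)) \<partial>lborel)" .
qed

end

section \<open>Existence, uniqueness and push-forward of the measure of a form\<close>

lemma representsD:
  assumes "represents A \<nu> \<mu>"
  shows "sets \<mu> = sets borel"
    and "c \<in> A \<Longrightarrow> B \<in> sets borel \<Longrightarrow> B \<subseteq> chart_dom c \<Longrightarrow>
      emeasure \<mu> B = (\<integral>\<^sup>+u\<in>chart_map c ` B. ennreal (\<nu> c (chart_inv c u)) \<partial>lborel)"
  using assms unfolding represents_def by blast+

context compact_oriented begin

text \<open>By compactness finitely many charts suffice, and making their domains disjoint keeps
  them Borel. Measures and integrals then split into finitely many pieces, each inside one
  chart.\<close>

lemma finite_borel_cover:
  obtains n :: nat and e and D :: "nat \<Rightarrow> 'm set"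
  where "\<And>i. i < n \<Longrightarrow> e i \<in> A" "\<And>i. i < n \<Longrightarrow> D i \<subseteq> chart_dom (e i)"
    "\<And>i. D i \<in> sets borel" "disjoint_family D" "(\<Union>i<n. D i) = UNIV"
proof -
  have "compact (UNIV :: 'm set)"
    using compact_oriented unfolding compact_oriented_manifold_def by blast
  moreover have "\<And>c. c \<in> A \<Longrightarrow> open (chart_dom c)"
    using chart is_chartD(1) by blast
  moreover have "UNIV \<subseteq> (\<Union>c\<in>A. chart_dom c)" by (metis UN_iff chart_at subsetI)
  ultimately obtain C where C: "C \<subseteq> A" "finite C" "UNIV \<subseteq> (\<Union>c\<in>C. chart_dom c)"
    by (rule compactE_image)
  obtain e where e: "bij_betw e {..<card C} C"
    using ex_bij_betw_nat_finite[OF C(2)] by (auto simp: atLeast0LessThan)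
  define n where "n = card C"
  \<comment> \<open>\<open>disjointed\<close> acts on infinite sequences, so the finite family is
    padded with empty sets.\<close>
  define U where "U i = (if i < n then chart_dom (e i) else {})" for i
  have eA: "e i \<in> A" if "i < n" for i
    using e C(1) that bij_betwE n_def by blast
  have U: "U i \<in> sets borel" for i
    using is_chartD(1)[OF chart[OF eA]] unfolding U_def by auto
  have "range (disjointed U) \<subseteq> sets borel"
    using U by (intro sets.range_disjointed_sets) auto
  moreover have "disjointed U i \<subseteq> chart_dom (e i)" if "i < n" for i
    using disjointed_subset[of U i] that unfolding U_def by simp
  moreover have "(\<Union>i<n. disjointed U i) = UNIV"
  proof -
    have "x \<in> (\<Union>i. U i)" for x
    proof -
      obtain c where c: "c \<in> C" "x \<in> chart_dom c" using C(3) by blast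
      then obtain i where "i < n" "c = e i"
        using e unfolding bij_betw_def n_def by (metis imageE lessThan_iff)
      then show ?thesis using c unfolding U_def by auto
    qed
    then have "x \<in> (\<Union>i. disjointed U i)" for x by (simp only: UN_disjointed_eq)
    moreover have "disjointed U i = {}" if "\<not> i < n" for i
      using disjointed_subset[of U i] that unfolding U_def by simp
    ultimately show ?thesis by blast
  qed
  ultimately show ?thesis
    using that[of n e "disjointed U"] eA disjoint_family_disjointed by blast
qed

lemma emeasure_disjoint_cover:
  fixes n :: nat
  assumes D: "\<And>i. D i \<in> sets borel" "disjoint_family D" "(\<Union>i<n. D i) = (UNIV :: 'm set)"
    and \<mu>: "sets \<mu> = sets borel" and B: "B \<in> sets borel"
  shows "emeasure \<mu> B = (\<Sum>i<n. emeasure \<mu> (B \<inter> D i))"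
proof -
  have "(\<Sum>i<n. emeasure \<mu> (B \<inter> D i)) = emeasure \<mu> (\<Union>i<n. B \<inter> D i)"
    using D(1,2) \<mu> B
    by (intro sum_emeasure) (auto simp: disjoint_family_on_def)
  moreover have "(\<Union>i<n. B \<inter> D i) = B" using D(3) by blast
  ultimately show ?thesis by simp
qed

text \<open>A Borel set is a finite disjoint union of pieces inside charts, where
  \<open>represents\<close> prescribes the value.\<close>

lemma represents_unique:
  assumes "represents A \<nu> \<mu>" "represents A \<nu> \<mu>'"
  shows "\<mu> = \<mu>'"
proof (rule measure_eqI)
  note sets = assms[THEN representsD(1)]
  show "sets \<mu> = sets \<mu>'" using sets by simp
  fix B assume "B \<in> sets \<mu>"
  then have B: "B \<in> sets borel" using sets by simp
  obtain n :: nat and e and D :: "nat \<Rightarrow> 'm set"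
  where D: "\<And>i. i < n \<Longrightarrow> e i \<in> A" "\<And>i. i < n \<Longrightarrow> D i \<subseteq> chart_dom (e i)"
    "\<And>i. D i \<in> sets borel" "disjoint_family D" "(\<Union>i<n. D i) = UNIV" by (rule finite_borel_cover) blast
  have "emeasure \<mu> (B \<inter> D i) = emeasure \<mu>' (B \<inter> D i)" if i: "i < n" for i
  proof -
    have *: "B \<inter> D i \<in> sets borel" "B \<inter> D i \<subseteq> chart_dom (e i)" using B D(2,3) i by auto
    show ?thesis by (simp only: assms[THEN representsD(2), OF D(1)[OF i] *])
  qed
  then show "emeasure \<mu> B = emeasure \<mu>' B"
    by (simp add: emeasure_disjoint_cover[OF D(3,4,5) _ B] sets)
qed

lemma form_measure_eqI:
  assumes "represents A \<nu> \<mu>" shows "form_measure A \<nu> = \<mu>"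
  unfolding form_measure_def represents_def[symmetric]
  using assms represents_unique[OF _ assms] by (rule the_equality)

text \<open>\<open>\<psi>\<close> may spread \<open>B\<close> over several charts, so
  \<open>B\<close> is cut along the preimages of the \<open>D i\<close> and the formula for one pair
  of charts is applied to each piece.\<close>

lemma nn_integral_form_pullback_cover:
  fixes n :: nat
  assumes D: "\<And>i. i < n \<Longrightarrow> e i \<in> A" "\<And>i. i < n \<Longrightarrow> D i \<subseteq> chart_dom (e i)"
    "\<And>i. D i \<in> sets borel" "disjoint_family D" "(\<Union>i<n. D i) = UNIV"
    and \<psi>: "orientation_preserving A \<psi>" "inj \<psi>" and \<nu>: "volume_form A \<nu>"
    and c: "c \<in> A" and B: "B \<in> sets borel" "B \<subseteq> chart_dom c" "\<psi> ` B \<in> sets borel"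
  shows "(\<Sum>i<n. \<integral>\<^sup>+u\<in>chart_map (e i) ` (\<psi> ` B \<inter> D i). ennreal (\<nu> (e i) (chart_inv (e i) u)) \<partial>lborel) =
    (\<integral>\<^sup>+u\<in>chart_map c ` B. ennreal (form_pullback A \<psi> \<nu> c (chart_inv c u)) \<partial>lborel)"
proof -
  let ?E = "\<lambda>i. B \<inter> \<psi> -` D i" and ?f = "\<lambda>u. ennreal (form_pullback A \<psi> \<nu> c (chart_inv c u))"
  have \<psi>b: "\<psi> \<in> borel_measurable borel"
    by (rule borel_measurable_continuous_onI[OF chart_differentiableD(1)[OF orientation_preservingD(1)[OF \<psi>(1)]]])
  have E: "?E i \<in> sets borel" for i
    using measurable_sets[OF \<psi>b D(3)] B(1) by auto
  have eq: "\<psi> ` ?E i = \<psi> ` B \<inter> D i" for i by auto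
  have E': "?E i \<subseteq> chart_dom c" for i using B(2) by blast
  have E'': "\<psi> ` ?E i \<in> sets borel" "i < n \<Longrightarrow> \<psi> ` ?E i \<subseteq> chart_dom (e i)" for i
    unfolding eq using B(3) D(2,3) by auto
  note pb = nn_integral_form_pullback[OF \<psi> \<nu> c D(1) E E' E'']
  have "(\<Sum>i<n. \<integral>\<^sup>+u\<in>chart_map (e i) ` (\<psi> ` B \<inter> D i). ennreal (\<nu> (e i) (chart_inv (e i) u)) \<partial>lborel) =
      (\<Sum>i<n. \<integral>\<^sup>+u\<in>chart_map c ` ?E i. ?f u \<partial>lborel)"
    using pb(2) unfolding eq by (intro sum.cong) auto
  \<comment> \<open>Exchanging sum and integral requires measurable summands, and measurability has
    been established for \<open>lebesgue\<close>.\<close>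
  also have "\<dots> = (\<Sum>i<n. \<integral>\<^sup>+u\<in>chart_map c ` ?E i. ?f u \<partial>lebesgue)"
    by (simp only: nn_integral_completion)
  also have "\<dots> = (\<integral>\<^sup>+u. (\<Sum>i<n. ?f u * indicator (chart_map c ` ?E i) u) \<partial>lebesgue)"
    using pb(1) by (intro nn_integral_sum[symmetric]) auto
  also have "\<dots> = (\<integral>\<^sup>+u\<in>chart_map c ` B. ?f u \<partial>lebesgue)"
  proof (intro nn_integral_cong)
    fix u
    have inv: "chart_inv c (chart_map c x) = x" if "x \<in> B" for x
      using is_chartD(3)[OF chart[OF c]] B(2) that by blast
    show "(\<Sum>i<n. ?f u * indicator (chart_map c ` ?E i) u) = ?f u * indicator (chart_map c ` B) u"
    proof (cases "u \<in> chart_map c ` B")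
      case True
      then obtain x where x: "x \<in> B" "u = chart_map c x" by blast
      obtain j where j: "j < n" "\<psi> x \<in> D j" using D(5) by blast
      \<comment> \<open>The chart is injective on \<open>B\<close>, so membership of
        \<open>u\<close> is decided by the one point \<open>x\<close> above it; disjointness of the
        \<open>D i\<close> then leaves a single nonzero summand.\<close>
      have mem: "u \<in> chart_map c ` ?E i \<longleftrightarrow> \<psi> x \<in> D i" for i
      proof
        assume "u \<in> chart_map c ` ?E i"
        then obtain y where y: "y \<in> B" "\<psi> y \<in> D i" "u = chart_map c y" by blast
        then have "y = x" using inv x by metis
        then show "\<psi> x \<in> D i" using y by simp
      qed (use x in blast)
      have "\<psi> x \<in> D i \<longleftrightarrow> i = j" for i
        using D(4) j(2) unfolding disjoint_family_on_def by (metis IntI UNIV_I empty_iff)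
      then have "(\<Sum>i<n. ?f u * indicator (chart_map c ` ?E i) u) = (\<Sum>i<n. if i = j then ?f u else 0)"
        by (intro sum.cong refl) (simp add: indicator_def mem)
      then show ?thesis using True j(1) by simp
    next
      case False
      then have "u \<notin> chart_map c ` ?E i" for i by blast
      then show ?thesis using False by (simp add: indicator_def)
    qed
  qed
  finally show ?thesis by (simp only: nn_integral_completion)
qed

text \<open>Each piece \<open>D i\<close> is measured in its own chart and the results are added.
  Any other chart \<open>c\<close> gives the same value by the change of variables formula for
  \<open>id\<close>, whose Jacobians are those of the coordinate changes.\<close>

lemma represents_form_measure:
  assumes \<nu>: "volume_form A \<nu>"
  shows "represents A \<nu> (form_measure A \<nu>)"
proof -
  have top: "top_form A \<nu>" using \<nu> unfolding volume_form_def by simp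
  obtain n :: nat and e and D :: "nat \<Rightarrow> 'm set"
  where D: "\<And>i. i < n \<Longrightarrow> e i \<in> A" "\<And>i. i < n \<Longrightarrow> D i \<subseteq> chart_dom (e i)"
    "\<And>i. D i \<in> sets borel" "disjoint_family D" "(\<Union>i<n. D i) = UNIV" by (rule finite_borel_cover) blast
  define m where "m B = (\<Sum>i<n. emeasure (chart_measure (e i) \<nu>) (B \<inter> D i))" for B
  define \<mu> where "\<mu> = measure_of UNIV (sets borel) m"
  have sets: "sets (chart_measure (e i) \<nu>) = sets borel" for i
    unfolding chart_measure_def by simp
  have "countably_additive (sets borel) m"
  proof (rule countably_additiveI)
    fix F :: "nat \<Rightarrow> 'm set"
    assume F: "range F \<subseteq> sets borel" "disjoint_family F"
    have "(\<Sum>j. m (F j)) = (\<Sum>i<n. \<Sum>j. emeasure (chart_measure (e i) \<nu>) (F j \<inter> D i))"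
      unfolding m_def by (intro suminf_sum) auto
    also have "\<dots> = (\<Sum>i<n. emeasure (chart_measure (e i) \<nu>) (\<Union>j. F j \<inter> D i))"
      using F D(3) sets
      by (intro sum.cong refl suminf_emeasure) (auto simp: disjoint_family_on_def image_subset_iff)
    also have "\<dots> = m (\<Union>j. F j)" unfolding m_def by simp
    finally show "(\<Sum>j. m (F j)) = m (\<Union>j. F j)" .
  qed
  moreover have "positive (sets borel) m" unfolding positive_def m_def by simp
  moreover have "sigma_algebra UNIV (sets (borel :: 'm measure))"
    using sets.sigma_algebra_axioms[of "borel :: 'm measure"] by simp
  ultimately have em: "emeasure \<mu> B = m B" if "B \<in> sets borel" for B
    using that unfolding \<mu>_def by (intro emeasure_measure_of_sigma)
  have "represents A \<nu> \<mu>"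
    unfolding represents_def
  proof (intro conjI ballI impI)
    show "sets \<mu> = sets borel"
      unfolding \<mu>_def using sets.sigma_sets_eq[of "borel :: 'm measure"] by simp
    fix c B assume c: "c \<in> A" and B: "B \<in> sets borel" "B \<subseteq> chart_dom c"
    have "emeasure \<mu> B = (\<Sum>i<n. \<integral>\<^sup>+u\<in>chart_map (e i) ` (B \<inter> D i). ennreal (\<nu> (e i) (chart_inv (e i) u)) \<partial>lborel)"
      unfolding em[OF B(1)] m_def
    proof (intro sum.cong refl emeasure_chart_measure)
      fix i assume "i \<in> {..<n}"
      then have i: "i < n" by simp
      show "is_chart (e i)" "top_form A \<nu>" "e i \<in> A" using chart top D(1)[OF i] by auto
      show "B \<inter> D i \<in> sets borel" "B \<inter> D i \<subseteq> chart_dom (e i)" using B(1) D(2,3) i by auto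
    qed
    also have "\<dots> = (\<integral>\<^sup>+u\<in>chart_map c ` B. ennreal (form_pullback A id \<nu> c (chart_inv c u)) \<partial>lborel)"
      using nn_integral_form_pullback_cover[OF D orientation_preserving_id inj_on_id \<nu> c B] B(1)
      by simp
    also have "\<dots> = (\<integral>\<^sup>+u\<in>chart_map c ` B. ennreal (\<nu> c (chart_inv c u)) \<partial>lborel)"
    proof (intro nn_integral_cong)
      fix u
      have "form_pullback A id \<nu> c (chart_inv c u) = \<nu> c (chart_inv c u)" if "u \<in> chart_map c ` B"
        using form_pullback_id[OF top c] is_chartD(5)[OF chart[OF c]] that B(2) by blast
      then show "ennreal (form_pullback A id \<nu> c (chart_inv c u)) * indicator (chart_map c ` B) u =
          ennreal (\<nu> c (chart_inv c u)) * indicator (chart_map c ` B) u"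
        by (simp add: indicator_def)
    qed
    finally show "emeasure \<mu> B = (\<integral>\<^sup>+u\<in>chart_map c ` B. ennreal (\<nu> c (chart_inv c u)) \<partial>lborel)" .
  qed
  then show ?thesis using form_measure_eqI by metis
qed

text \<open>The image measure is checked against the characterisation by charts: the preimage of
  \<open>B\<close> under \<open>\<phi>\<close> is its image under \<open>inv \<phi>\<close>, and the
  push-forward is by definition a pullback along \<open>inv \<phi>\<close>.\<close>

lemma form_measure_pushforward:
  assumes \<phi>: "bij \<phi>" "continuous_on UNIV \<phi>" "orientation_preserving A (inv \<phi>)"
    and \<nu>: "volume_form A \<nu>"
  shows "form_measure A (form_pushforward A \<phi> \<nu>) = distr (form_measure A \<nu>) borel \<phi>"
proof (rule form_measure_eqI, unfold represents_def form_pushforward_def, intro conjI ballI impI)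
  let ?\<mu> = "form_measure A \<nu>" and ?\<psi> = "inv \<phi>"
  note rep = representsD[OF represents_form_measure[OF \<nu>]]
  note sets = rep(1)
  have \<phi>b: "\<phi> \<in> ?\<mu> \<rightarrow>\<^sub>M borel"
    using borel_measurable_continuous_onI[OF \<phi>(2)] sets by (simp cong: measurable_cong_sets)
  have \<psi>: "inj ?\<psi>" using \<phi>(1) by (simp add: bij_imp_bij_inv bij_is_inj)
  obtain n :: nat and e and D :: "nat \<Rightarrow> 'm set"
  where D: "\<And>i. i < n \<Longrightarrow> e i \<in> A" "\<And>i. i < n \<Longrightarrow> D i \<subseteq> chart_dom (e i)"
    "\<And>i. D i \<in> sets borel" "disjoint_family D" "(\<Union>i<n. D i) = UNIV" by (rule finite_borel_cover) blast
  show "sets (distr ?\<mu> borel \<phi>) = sets borel" by simp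
  fix c B assume c: "c \<in> A" and B: "B \<in> sets borel" "B \<subseteq> chart_dom c"
  have "space ?\<mu> = UNIV" using sets_eq_imp_space_eq[OF sets] by simp
  moreover have vimage: "\<phi> -` B = ?\<psi> ` B" using \<phi>(1) by (rule bij_vimage_eq_inv_image)
  ultimately have \<psi>B: "?\<psi> ` B \<in> sets borel"
    and em: "emeasure (distr ?\<mu> borel \<phi>) B = emeasure ?\<mu> (?\<psi> ` B)"
    using measurable_sets[OF \<phi>b B(1)] emeasure_distr[OF \<phi>b B(1)] sets by auto
  have "emeasure ?\<mu> (?\<psi> ` B) = (\<Sum>i<n. emeasure ?\<mu> (?\<psi> ` B \<inter> D i))"
    by (rule emeasure_disjoint_cover[OF D(3,4,5) sets \<psi>B])
  also have "\<dots> = (\<Sum>i<n. \<integral>\<^sup>+u\<in>chart_map (e i) ` (?\<psi> ` B \<inter> D i). ennreal (\<nu> (e i) (chart_inv (e i) u)) \<partial>lborel)"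
  proof (intro sum.cong refl)
    fix i assume "i \<in> {..<n}"
    then have i: "i < n" by simp
    have "?\<psi> ` B \<inter> D i \<in> sets borel" "?\<psi> ` B \<inter> D i \<subseteq> chart_dom (e i)" using \<psi>B D(2,3) i by auto
    then show "emeasure ?\<mu> (?\<psi> ` B \<inter> D i) =
        (\<integral>\<^sup>+u\<in>chart_map (e i) ` (?\<psi> ` B \<inter> D i). ennreal (\<nu> (e i) (chart_inv (e i) u)) \<partial>lborel)"
      by (rule rep(2)[OF D(1)[OF i]])
  qed
  also have "\<dots> = (\<integral>\<^sup>+u\<in>chart_map c ` B. ennreal (form_pullback A ?\<psi> \<nu> c (chart_inv c u)) \<partial>lborel)"
    by (rule nn_integral_form_pullback_cover[OF D \<phi>(3) \<psi> \<nu> c B \<psi>B])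
  finally show "emeasure (distr ?\<mu> borel \<phi>) B =
      (\<integral>\<^sup>+u\<in>chart_map c ` B. ennreal (form_pullback A ?\<psi> \<nu> c (chart_inv c u)) \<partial>lborel)"
    unfolding em .
qed

lemma linear_functional_pushforward:
  assumes \<phi>: "bij \<phi>" "continuous_on UNIV \<phi>" "orientation_preserving A (inv \<phi>)"
    and \<nu>: "volume_form A \<nu>" and f: "f \<circ> \<phi> = f"
  shows "linear_functional A f (form_pushforward A \<phi> \<nu>) = linear_functional A f \<nu>"
proof -
  let ?\<mu> = "form_measure A \<nu>"
  note sets = representsD(1)[OF represents_form_measure[OF \<nu>]]
  have \<phi>b: "\<phi> \<in> ?\<mu> \<rightarrow>\<^sub>M borel"
    using borel_measurable_continuous_onI[OF \<phi>(2)] sets by (simp cong: measurable_cong_sets)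
  show ?thesis
  \<comment> \<open>\<open>f\<close> will be \<open>h \<circ> l\<close> with an arbitrary
    \<open>h\<close>, so measurability is a case and not a hypothesis.\<close>
  proof (cases "f \<in> borel_measurable borel")
    case True
    then have "(\<integral>x. f x \<partial>distr ?\<mu> borel \<phi>) = (\<integral>x. f (\<phi> x) \<partial>?\<mu>)"
      by (rule integral_distr[OF \<phi>b])
    also have "\<dots> = (\<integral>x. f x \<partial>?\<mu>)" using f by (simp add: fun_eq_iff)
    finally show ?thesis
      unfolding linear_functional_def form_measure_pushforward[OF \<phi>(1,2,3) \<nu>] .
  next
    \<comment> \<open>both integrals are the junk value \<open>0\<close>\<close>
    case False
    then have "\<not> integrable ?\<mu> f" "\<not> integrable (distr ?\<mu> borel \<phi>) f"
      using sets by (auto dest!: borel_measurable_integrable cong: measurable_cong_sets)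
    then show ?thesis
      unfolding linear_functional_def form_measure_pushforward[OF \<phi>(1,2,3) \<nu>]
      by (simp add: not_integrable_integral_eq)
  qed
qed

end

section \<open>Hamiltonian flows\<close>

lemma smooth_on_frechet_continuous:
  assumes "smooth_on S f"
  shows "continuous_on S (\<lambda>x. frechet_derivative f (at x) v)"
proof -
  have "Ck_on (Suc 0) S f" using assms unfolding smooth_on_def by blast
  then show ?thesis by simp
qed

text \<open>The Jacobian of a flow at a fixed time involves the spatial derivative alone. Expressing
  it by the joint derivative along \<open>(0, v)\<close> lets it inherit continuity in time.\<close>

lemma frechet_derivative_Pair_right:
  assumes "F differentiable (at (t, u))"
  shows "(\<lambda>u. F (t, u)) differentiable (at u)"
    and "frechet_derivative (\<lambda>u. F (t, u)) (at u) = (\<lambda>v. frechet_derivative F (at (t, u)) (0, v))"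
proof -
  have "((\<lambda>u. F (t, u)) has_derivative (\<lambda>v. frechet_derivative F (at (t, u)) (0, v))) (at u)"
    by (rule has_derivative_compose[OF has_derivative_Pair[OF has_derivative_const has_derivative_ident]
          assms[unfolded frechet_derivative_works]])
  then show "(\<lambda>u. F (t, u)) differentiable (at u)"
    and "frechet_derivative (\<lambda>u. F (t, u)) (at u) = (\<lambda>v. frechet_derivative F (at (t, u)) (0, v))"
    using frechet_derivative_at differentiableI by metis+
qed

context compact_oriented begin

lemma ham_flowD:
  assumes "ham_flow A P f \<Phi>"
  shows "\<Phi> 0 = id" "\<Phi> (s + t) = \<Phi> s \<circ> \<Phi> t" "\<Phi> t \<circ> \<Phi> (- t) = id" "\<Phi> (- t) \<circ> \<Phi> t = id"
    "continuous_on UNIV (\<Phi> t)" "continuous_on UNIV (\<lambda>t. \<Phi> t x)"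
proof -
  have *: "\<Phi> 0 = id" "\<And>s t. \<Phi> (s + t) = \<Phi> s \<circ> \<Phi> t"
    and cont: "continuous_on UNIV (\<lambda>(t, x). \<Phi> t x)"
    using assms unfolding ham_flow_def by blast+
  show "\<Phi> 0 = id" "\<Phi> (s + t) = \<Phi> s \<circ> \<Phi> t" by (rule *)+
  show "\<Phi> t \<circ> \<Phi> (- t) = id" "\<Phi> (- t) \<circ> \<Phi> t = id"
    using *(1) *(2)[of t "- t"] *(2)[of "- t" t] by simp_all
  show "continuous_on UNIV (\<Phi> t)"
    using continuous_on_compose2[OF cont, of UNIV "\<lambda>x. (t, x)"] by (simp add: continuous_on_Pair)
  show "continuous_on UNIV (\<lambda>t. \<Phi> t x)"
    using continuous_on_compose2[OF cont, of UNIV "\<lambda>t. (t, x)"] by (simp add: continuous_on_Pair)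
qed

text \<open>In charts a flow is smooth jointly in time and space. Fixing the time gives
  differentiability; fixing the point gives continuity of the partial derivatives, hence of the
  determinant, a polynomial in them.\<close>

lemma ham_flow_chart_rep:
  assumes \<Phi>: "ham_flow A P f \<Phi>" and A: "c \<in> A" "d \<in> A" and x: "x \<in> chart_dom c"
  shows "\<Phi> t x \<in> chart_dom d \<Longrightarrow> chart_rep c d (\<Phi> t) differentiable (at (chart_map c x))"
    and "continuous_on {t. \<Phi> t x \<in> chart_dom d} (\<lambda>t. jacobian_det (chart_rep c d (\<Phi> t)) (chart_map c x))"
proof -
  let ?W = "{(t, u). u \<in> chart_image c \<and> \<Phi> t (chart_inv c u) \<in> chart_dom d}"
  let ?F = "\<lambda>(t, u). chart_map d (\<Phi> t (chart_inv c u))"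
  let ?u = "chart_map c x"
  have smooth: "smooth_on ?W ?F" using \<Phi> A unfolding ham_flow_def by blast
  have W: "(t, ?u) \<in> ?W \<longleftrightarrow> \<Phi> t x \<in> chart_dom d" for t
    using is_chartD(3)[OF chart[OF A(1)] x] x by simp
  have rep: "chart_rep c d (\<Phi> t) = (\<lambda>u. ?F (t, u))" for t
    unfolding chart_rep_def by (simp add: fun_eq_iff)
  note diff = frechet_derivative_Pair_right[OF smooth_on_differentiable[OF smooth]]
  show "chart_rep c d (\<Phi> t) differentiable (at ?u)" if "\<Phi> t x \<in> chart_dom d"
    unfolding rep by (rule diff(1)[OF iffD2[OF W that]])
  have eq: "jacobian_det (chart_rep c d (\<Phi> t)) ?u =
      det (matrix (\<lambda>v. frechet_derivative ?F (at (t, ?u)) (0, v)))" if "t \<in> {t. \<Phi> t x \<in> chart_dom d}" for t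
    unfolding jacobian_det_def rep by (simp only: diff(2)[OF iffD2[OF W that[unfolded mem_Collect_eq]]])
  have "continuous_on {t. \<Phi> t x \<in> chart_dom d} (\<lambda>t. frechet_derivative ?F (at (t, ?u)) v)" for v
    by (rule continuous_on_compose2[OF smooth_on_frechet_continuous[OF smooth]])
      (use W in \<open>auto intro!: continuous_intros\<close>)
  then have "continuous_on {t. \<Phi> t x \<in> chart_dom d}
      (\<lambda>t. det (matrix (\<lambda>v. frechet_derivative ?F (at (t, ?u)) (0, v))))"
    unfolding det_def matrix_def by (auto intro!: continuous_intros)
  then show "continuous_on {t. \<Phi> t x \<in> chart_dom d} (\<lambda>t. jacobian_det (chart_rep c d (\<Phi> t)) ?u)"
    by (rule continuous_on_eq[OF _ eq[symmetric]])
qed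

text \<open>The Jacobian of a flow along an orbit never vanishes, and its sign, which does not depend on the
  chart at the end point, is locally constant in the time; at time \<open>0\<close> it is positive.\<close>

lemma ham_flow_orientation_preserving:
  assumes \<Phi>: "ham_flow A P f \<Phi>"
  shows "orientation_preserving A (\<Phi> t)"
proof -
  note flow = ham_flowD[OF \<Phi>]
  have diff: "chart_differentiable A (\<Phi> t)" for t
    unfolding chart_differentiable_def using flow(5) ham_flow_chart_rep(1)[OF \<Phi>] by blast
  note op_id = orientation_preserving_id
  note diff_id = orientation_preservingD(1)[OF op_id]
  have "jacobian_det (chart_rep c d (\<Phi> t)) (chart_map c x) > 0"
    if c: "c \<in> A" "x \<in> chart_dom c" and d: "d \<in> A" "\<Phi> t x \<in> chart_dom d" for c d x
  proof -
    let ?J = "\<lambda>d t. jacobian_det (chart_rep c d (\<Phi> t)) (chart_map c x)"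
    let ?T = "\<lambda>d. {t. \<Phi> t x \<in> chart_dom d}"
    \<comment> \<open>The chain rule for \<open>\<Phi> (- t) \<circ> \<Phi> t = id\<close> exhibits
      \<open>?J d t\<close> as a factor of a positive number.\<close>
    have nz: "?J d t \<noteq> 0" if d: "d \<in> A" "t \<in> ?T d" for d t
    proof -
      have x: "\<Phi> t x \<in> chart_dom d" "\<Phi> (- t) (\<Phi> t x) = x"
        using d flow(4)[of t] by (auto simp: fun_eq_iff)
      have "jacobian_det (chart_rep d c (\<Phi> (- t))) (chart_map d (\<Phi> t x)) * ?J d t =
          jacobian_det (chart_rep c c id) (chart_map c x)"
        using chart_rep_compose(2)[OF diff[of t] diff[of "- t"] c(1) d(1) c(1,2) x(1)] x(2) c(2)
        unfolding flow(4) by simp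
      moreover have "jacobian_det (chart_rep c c id) (chart_map c x) > 0"
        using orientation_preservingD(2)[OF op_id c(1,1,2)] c(2) by simp
      ultimately show ?thesis by auto
    qed
    have sgn: "?J e t > 0" if de: "d \<in> A" "t \<in> ?T d" "e \<in> A" "t \<in> ?T e" and J: "?J d t > 0" for d e t
    proof -
      have x: "\<Phi> t x \<in> chart_dom d" "id (\<Phi> t x) \<in> chart_dom e" using de by auto
      have eq: "?J e t = jacobian_det (chart_rep d e id) (chart_map d (\<Phi> t x)) * ?J d t"
        using chart_rep_compose(2)[OF diff[of t] diff_id c(1) de(1,3) c(2) x] unfolding id_o .
      show ?thesis
        unfolding eq by (rule mult_pos_pos[OF orientation_preservingD(2)[OF op_id de(1,3) x] J])
    qed
    have openT: "open (?T d)" if "d \<in> A" for d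
      using open_vimage[OF is_chartD(1)[OF chart[OF that]] flow(6)[of x]] by (simp add: vimage_def)
    have opn: "open ((\<lambda>t. ?J d t) -` S \<inter> ?T d)" if "d \<in> A" "open S" for d S
      using ham_flow_chart_rep(2)[OF \<Phi> c(1) that(1) c(2)] openT[OF that(1)] that(2)
      by (metis (no_types, lifting) continuous_on_open_vimage)
    \<comment> \<open>The orbit may leave a chart, so both sets range over all charts at its end
      point: \<open>nz\<close> makes them cover the time line and \<open>sgn\<close> makes them
      disjoint.\<close>
    let ?P = "\<Union>d\<in>A. (\<lambda>t. ?J d t) -` {0<..} \<inter> ?T d" and ?N = "\<Union>d\<in>A. (\<lambda>t. ?J d t) -` {..<0} \<inter> ?T d"
    have "open ?P" "open ?N" using opn by auto
    moreover have "UNIV \<subseteq> ?P \<union> ?N"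
    proof
      fix s :: real
      obtain d where "d \<in> A" "\<Phi> s x \<in> chart_dom d" by (rule chart_at)
      then show "s \<in> ?P \<union> ?N" using nz[of d s] by (auto simp: linorder_neq_iff)
    qed
    moreover have "s \<notin> ?N" if "s \<in> ?P" for s
    proof
      assume "s \<in> ?N"
      then obtain e where e: "e \<in> A" "s \<in> ?T e" "?J e s < 0" by blast
      obtain d where d: "d \<in> A" "s \<in> ?T d" "0 < ?J d s" using \<open>s \<in> ?P\<close> by blast
      show False using sgn[OF d(1,2) e(1,2) d(3)] e(3) by linarith
    qed
    then have "?P \<inter> ?N \<inter> UNIV = {}" by blast
    moreover have "0 \<in> ?P"
    proof -
      have "0 < ?J c 0" "\<Phi> 0 x \<in> chart_dom c"
        unfolding flow(1) using orientation_preservingD(2)[OF op_id c(1,1,2)] c(2) by simp_all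
      then show ?thesis using c(1) by blast
    qed
    ultimately have "?N \<inter> UNIV = {}"
      using connectedD[OF connected_UNIV, of ?P ?N] by blast
    then have "\<not> ?J d t < 0" using d by blast
    then show ?thesis using nz[of d t] d by simp
  qed
  with diff show ?thesis unfolding orientation_preserving_def by blast
qed

section \<open>Invariance under the group of Hamiltonian diffeomorphisms\<close>

lemma casimir_flow_invariant:
  assumes l: "casimir A P l" and f: "smooth_fun A f" and \<Phi>: "ham_flow A P f \<Phi>"
  shows "l (\<Phi> t x) = l x"
proof -
  have *: "l (\<Phi> t x) = l x" if t: "0 \<le> t" for t x
  proof -
    have "ham_integral_curve A P f UNIV (\<lambda>t. \<Phi> t x)" using \<Phi> unfolding ham_flow_def by blast
    then have "ham_integral_curve A P f {0..t} (\<lambda>t. \<Phi> t x)"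
      unfolding ham_integral_curve_def
      by (meson UNIV_I continuous_on_subset has_field_derivative_subset subset_UNIV)
    then have "(x, \<Phi> t x) \<in> ham_connected A P"
      using f t ham_flowD(1)[OF \<Phi>] unfolding ham_connected_def by fastforce
    then show ?thesis using l unfolding casimir_def symplectic_leaf_def by blast
  qed
  show ?thesis
  proof (cases "0 \<le> t")
    \<comment> \<open>Leaves are built from curves run forward in time. For negative
      \<open>t\<close> the forward time \<open>- t\<close> leads from \<open>\<Phi> t x\<close> back
      to \<open>x\<close>.\<close>
    case False
    have "\<Phi> (- t) (\<Phi> t x) = x" using ham_flowD(4)[OF \<Phi>, of t] by (simp add: fun_eq_iff)
    then show ?thesis using *[of "- t" "\<Phi> t x"] False by simp
  qed (rule *)
qed

text \<open>It is \<open>inv \<phi>\<close> that must preserve the orientation, since a push-forward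
  is a pullback along the inverse. In the induction step the inverse is
  \<open>inv \<phi> \<circ> \<Phi> (- t)\<close>, and \<open>\<Phi> (- t)\<close> belongs to the
  same flow.\<close>

lemma ham_group_properties:
  assumes l: "casimir A P l" and \<phi>: "\<phi> \<in> ham_group A P"
  shows "bij \<phi> \<and> continuous_on UNIV \<phi> \<and> orientation_preserving A (inv \<phi>) \<and> l \<circ> \<phi> = l"
  using \<phi>
proof induction
  case id
  show ?case
    unfolding inv_id comp_id using orientation_preserving_id
    by (intro conjI bij_id chart_differentiableD(1)[OF orientation_preservingD(1)] refl)
next
  case (flow \<phi> f \<Phi> t)
  note \<Phi> = ham_flowD[OF flow(3)]
  have bij: "bij (\<Phi> t)" using \<Phi>(3,4) by (rule o_bij[rotated])
  have inv: "inv (\<Phi> t) = \<Phi> (- t)" using \<Phi>(3,4) by (rule inv_unique_comp)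
  have "bij (\<Phi> t \<circ> \<phi>)" using flow bij by (simp add: bij_comp)
  moreover have "continuous_on UNIV (\<Phi> t \<circ> \<phi>)"
    using flow \<Phi>(5) by (metis continuous_on_compose continuous_on_subset subset_UNIV)
  moreover have "inv (\<Phi> t \<circ> \<phi>) = inv \<phi> \<circ> \<Phi> (- t)"
    using flow bij inv by (simp add: o_inv_distrib bij_is_inj bij_is_surj)
  then have "orientation_preserving A (inv (\<Phi> t \<circ> \<phi>))"
    using orientation_preserving_compose[OF ham_flow_orientation_preserving[OF flow(3)]] flow by simp
  moreover have "l \<circ> (\<Phi> t \<circ> \<phi>) = l"
    using flow casimir_flow_invariant[OF l flow(2,3)] by (simp add: fun_eq_iff)
  ultimately show ?case by blast
qed

lemma casimir_functional_dens_casimir: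
  assumes "casimir A P l"
  shows "dens_casimir A P (casimir_functional A h l)"
  unfolding dens_casimir_def dens_leaf_def casimir_functional_def
proof (intro ballI, elim imageE, hypsubst)
  fix \<nu> \<phi> assume "\<nu> \<in> Dens A" and \<phi>: "\<phi> \<in> ham_group A P"
  then have \<nu>: "volume_form A \<nu>" unfolding Dens_def by simp
  have \<phi>': "bij \<phi>" "continuous_on UNIV \<phi>" "orientation_preserving A (inv \<phi>)" "(h \<circ> l) \<circ> \<phi> = h \<circ> l"
    using ham_group_properties[OF assms \<phi>] by (simp_all add: o_assoc[symmetric])
  show "linear_functional A (h \<circ> l) (form_pushforward A \<phi> \<nu>) = linear_functional A (h \<circ> l) \<nu>"
    by (rule linear_functional_pushforward[OF \<phi>'(1-3) \<nu> \<phi>'(4)])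
qed

end

section \<open>Algebra of smooth functions\<close>

text \<open>\<open>frechet_derivative\<close> is a choice among the derivatives at a point, and both
  functions have the same ones; so points of non-differentiability are covered too.\<close>

lemma frechet_derivative_within_open_cong:
  assumes "open S" "x \<in> S" "\<And>y. y \<in> S \<Longrightarrow> f y = g y"
  shows "frechet_derivative f (at x) = frechet_derivative g (at x)"
proof -
  have "(f has_derivative D) (at x) \<longleftrightarrow> (g has_derivative D) (at x)" for D
    using has_derivative_transform_within_open[OF _ assms(1,2), of _ _ UNIV] assms(3) by metis
  then show ?thesis unfolding frechet_derivative_def by simp
qed

text \<open>The sum and product rules give the derivative only at points of \<open>S\<close>; with
  this lemma the formula can replace \<open>frechet_derivative\<close> in the inductions
  below.\<close>

lemma Ck_on_cong:
  assumes "open S" "Ck_on k S f" "\<And>x. x \<in> S \<Longrightarrow> f x = g x"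
  shows "Ck_on k S g"
  using assms(2,3)
proof (induction k arbitrary: f g)
  case 0
  then show ?case by (simp cong: continuous_on_cong)
next
  case (Suc k)
  have "g differentiable (at x)" if "x \<in> S" for x
  proof -
    have "f differentiable (at x)" using Suc.prems(1) that by simp
    from this[unfolded frechet_derivative_works] show ?thesis
      by (intro differentiableI[OF has_derivative_transform_within_open[OF _ assms(1) that Suc.prems(2)]])
  qed
  moreover have "Ck_on k S (\<lambda>x. frechet_derivative g (at x) v)" for v
  proof (rule Suc.IH)
    show "Ck_on k S (\<lambda>x. frechet_derivative f (at x) v)" using Suc.prems(1) by simp
    show "frechet_derivative f (at x) v = frechet_derivative g (at x) v" if "x \<in> S" for x
      by (simp only: frechet_derivative_within_open_cong[OF assms(1) that Suc.prems(2)])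
  qed
  ultimately show ?case by simp
qed

lemma Ck_on_Suc_imp: "Ck_on (Suc k) S f \<Longrightarrow> Ck_on k S f"
proof (induction k arbitrary: f)
  case 0
  then have "\<forall>x\<in>S. f differentiable (at x)" by simp
  then have "continuous_on S f"
    by (intro continuous_at_imp_continuous_on) (auto intro: differentiable_imp_continuous_within)
  then show ?case by simp
next
  case (Suc k)
  then show ?case by (metis Ck_on.simps(2))
qed

lemma Ck_on_const: "Ck_on k S (\<lambda>x. c)"
  by (induction k arbitrary: c) simp_all

lemma Ck_on_add:
  assumes S: "open S"
  shows "Ck_on k S f \<Longrightarrow> Ck_on k S g \<Longrightarrow> Ck_on k S (\<lambda>x. f x + g x)"
proof (induction k arbitrary: f g)
  case 0
  then show ?case by (simp add: continuous_on_add)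
next
  case (Suc k)
  have d: "f differentiable (at x)" "g differentiable (at x)" if "x \<in> S" for x
    using Suc.prems that by auto
  have "Ck_on k S (\<lambda>x. frechet_derivative (\<lambda>x. f x + g x) (at x) v)" for v
  proof (rule Ck_on_cong[OF S Suc.IH])
    show "Ck_on k S (\<lambda>x. frechet_derivative f (at x) v)" "Ck_on k S (\<lambda>x. frechet_derivative g (at x) v)"
      using Suc.prems by auto
    fix x assume x: "x \<in> S"
    have "((\<lambda>x. f x + g x) has_derivative
        (\<lambda>v. frechet_derivative f (at x) v + frechet_derivative g (at x) v)) (at x)"
      by (intro has_derivative_add d[OF x, unfolded frechet_derivative_works])
    from fun_cong[OF frechet_derivative_at[OF this], of v]
    show "frechet_derivative f (at x) v + frechet_derivative g (at x) v =
        frechet_derivative (\<lambda>x. f x + g x) (at x) v" .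
  qed
  then show ?case using d by simp
qed

text \<open>Each term of the product rule keeps one factor undifferentiated;
  \<open>Ck_on_Suc_imp\<close> lowers its order to that of the differentiated factor, where the
  induction hypothesis applies.\<close>

lemma Ck_on_mult:
  fixes f g :: "'a::euclidean_space \<Rightarrow> real"
  assumes S: "open S"
  shows "Ck_on k S f \<Longrightarrow> Ck_on k S g \<Longrightarrow> Ck_on k S (\<lambda>x. f x * g x)"
proof (induction k arbitrary: f g)
  case 0
  then show ?case by (simp add: continuous_on_mult)
next
  case (Suc k)
  have d: "f differentiable (at x)" "g differentiable (at x)" if "x \<in> S" for x
    using Suc.prems that by auto
  have k: "Ck_on k S f" "Ck_on k S g"
    "Ck_on k S (\<lambda>x. frechet_derivative f (at x) v)" "Ck_on k S (\<lambda>x. frechet_derivative g (at x) v)" for v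
    using Suc.prems Ck_on_Suc_imp by auto
  have "Ck_on k S (\<lambda>x. frechet_derivative (\<lambda>x. f x * g x) (at x) v)" for v
  proof (rule Ck_on_cong[OF S Ck_on_add[OF S Suc.IH[OF k(1) k(4)[of v]] Suc.IH[OF k(3)[of v] k(2)]]])
    fix x assume x: "x \<in> S"
    have "((\<lambda>x. f x * g x) has_derivative
        (\<lambda>v. f x * frechet_derivative g (at x) v + frechet_derivative f (at x) v * g x)) (at x)"
      by (intro has_derivative_mult d[OF x, unfolded frechet_derivative_works])
    from fun_cong[OF frechet_derivative_at[OF this], of v]
    show "f x * frechet_derivative g (at x) v + frechet_derivative f (at x) v * g x =
        frechet_derivative (\<lambda>x. f x * g x) (at x) v" .
  qed
  then show ?case using d by simp
qed

lemma smooth_on_mult: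
  fixes f g :: "'a::euclidean_space \<Rightarrow> real"
  assumes "open S" "smooth_on S f" "smooth_on S g"
  shows "smooth_on S (\<lambda>x. f x * g x)"
  using assms Ck_on_mult unfolding smooth_on_def by blast

lemma smooth_on_add:
  assumes "open S" "smooth_on S f" "smooth_on S g"
  shows "smooth_on S (\<lambda>x. f x + g x)"
  using assms Ck_on_add unfolding smooth_on_def by blast

context compact_oriented begin

lemma smooth_fun_const: "smooth_fun A (\<lambda>x. k)"
  unfolding smooth_fun_def smooth_on_def by (simp add: comp_def Ck_on_const)

lemma smooth_fun_add: "smooth_fun A f \<Longrightarrow> smooth_fun A g \<Longrightarrow> smooth_fun A (\<lambda>x. f x + g x)"
  using smooth_on_add[OF is_chartD(2)[OF chart]] unfolding smooth_fun_def comp_def by blast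

lemma smooth_fun_mult: "smooth_fun A f \<Longrightarrow> smooth_fun A g \<Longrightarrow> smooth_fun A (\<lambda>x. f x * g x)"
  using smooth_on_mult[OF is_chartD(2)[OF chart]] unfolding smooth_fun_def comp_def by blast

lemma smooth_fun_power: "smooth_fun A f \<Longrightarrow> smooth_fun A (\<lambda>x. f x ^ n)"
  by (induction n) (simp_all add: smooth_fun_const smooth_fun_mult)

lemma smooth_fun_sum:
  "(\<And>i. i \<in> I \<Longrightarrow> smooth_fun A (f i)) \<Longrightarrow> smooth_fun A (\<lambda>x. \<Sum>i\<in>I. f i x)"
  by (induction I rule: infinite_finite_induct) (simp_all add: smooth_fun_const smooth_fun_add)

section \<open>Continuity from charts, and multiples of forms by functions\<close>

lemma continuous_on_charts:
  assumes "\<And>c. c \<in> A \<Longrightarrow> continuous_on (chart_dom c) f"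
  shows "continuous_on UNIV f"
proof -
  have "continuous_on (\<Union>c\<in>A. chart_dom c) f"
    using assms is_chartD(1)[OF chart] by (intro continuous_on_open_UN) auto
  moreover have "(\<Union>c\<in>A. chart_dom c) = UNIV" by (metis UNIV_eq_I UN_iff chart_at)
  ultimately show ?thesis by simp
qed

lemma continuous_on_chart_dom:
  assumes c: "c \<in> A" and f: "continuous_on (chart_image c) (f \<circ> chart_inv c)"
  shows "continuous_on (chart_dom c) f"
proof -
  note c' = is_chartD[OF chart[OF c]]
  have "continuous_on (chart_dom c) (\<lambda>x. (f \<circ> chart_inv c) (chart_map c x))"
    by (rule continuous_on_compose2[OF f c'(6)]) simp
  then show ?thesis
    by (rule continuous_on_eq) (simp add: c'(3))
qed

lemma smooth_fun_continuous:
  assumes "smooth_fun A f" shows "continuous_on UNIV f"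
proof (intro continuous_on_charts continuous_on_chart_dom)
  fix c assume "c \<in> A"
  then have "Ck_on 0 (chart_image c) (f \<circ> chart_inv c)"
    using assms unfolding smooth_fun_def smooth_on_def by blast
  then show "continuous_on (chart_image c) (f \<circ> chart_inv c)" by simp
qed

lemma top_form_smooth_mult:
  assumes f: "smooth_fun A f" and \<nu>: "top_form A \<nu>"
  shows "top_form A (\<lambda>c x. f x * \<nu> c x)"
  unfolding top_form_def
proof (intro conjI allI impI ballI)
  show "f x * \<nu> c x = 0" if "\<not> (c \<in> A \<and> x \<in> chart_dom c)" for c x
  proof -
    have "\<nu> c x = 0" using \<nu> that unfolding top_form_def by blast
    then show ?thesis by simp
  qed
  show "smooth_on (chart_image c) ((\<lambda>x. f x * \<nu> c x) \<circ> chart_inv c)" if "c \<in> A" for c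
    using smooth_on_mult[OF is_chartD(2)[OF chart[OF that]], of "f \<circ> chart_inv c" "\<nu> c \<circ> chart_inv c"]
      f \<nu> that unfolding top_form_def smooth_fun_def comp_def by blast
  show "f x * \<nu> c x = jacobian_det (coord_change c d) (chart_map c x) * (f x * \<nu> d x)"
    if "c \<in> A" "d \<in> A" "x \<in> chart_dom c \<inter> chart_dom d" for c d x
  proof -
    have "\<nu> c x = jacobian_det (coord_change c d) (chart_map c x) * \<nu> d x"
      using \<nu> that unfolding top_form_def by blast
    then show ?thesis by simp
  qed
qed

section \<open>Densities with respect to a volume form\<close>

text \<open>\<open>represents\<close> speaks of sets; the passage to functions identifies two
  measures (\<open>eq\<close>), the restriction of the form measure to \<open>B\<close> and the
  transported coordinate density, and integrates against both.\<close>

lemma set_nn_integral_form_measure: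
  assumes \<nu>: "volume_form A \<nu>" and f: "f \<in> borel_measurable borel" and c: "c \<in> A"
    and B: "B \<in> sets borel" "B \<subseteq> chart_dom c"
  shows "(\<integral>\<^sup>+x\<in>B. f x \<partial>form_measure A \<nu>) =
    (\<integral>\<^sup>+u\<in>chart_map c ` B. ennreal (\<nu> c (chart_inv c u)) * f (chart_inv c u) \<partial>lborel)"
proof -
  let ?\<mu> = "form_measure A \<nu>" and ?S = "chart_map c ` B"
  note c' = is_chartD[OF chart[OF c]]
  have top: "top_form A \<nu>" using \<nu> unfolding volume_form_def by simp
  note rep = representsD[OF represents_form_measure[OF \<nu>]]
  have [measurable_cong]: "sets ?\<mu> = sets borel" by (rule rep(1))
  note [measurable] = f B(1) chart_inv_borel[OF chart[OF c]] chart_density_measurable[OF chart[OF c] top c]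
    chart_map_image_borel[OF chart[OF c] B]
  define w where "w u = ennreal (chart_density c \<nu> u) * indicator ?S u" for u
  have [measurable]: "w \<in> borel_measurable borel" unfolding w_def by measurable
  have w: "w u = ennreal (\<nu> c (chart_inv c u)) * indicator ?S u" for u
    using B(2) unfolding w_def chart_density_def by (auto simp: indicator_def)
  have eq: "density ?\<mu> (indicator B) = distr (density lborel w) borel (chart_inv c)"
  proof (rule measure_eqI)
    show "sets (density ?\<mu> (indicator B)) = sets (distr (density lborel w) borel (chart_inv c))"
      using rep(1) by simp
    fix C assume "C \<in> sets (density ?\<mu> (indicator B))"
    then have C[measurable]: "C \<in> sets borel" using rep(1) by simp
    have "emeasure (density ?\<mu> (indicator B)) C = (\<integral>\<^sup>+x. indicator (B \<inter> C) x \<partial>?\<mu>)"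
      unfolding indicator_inter_arith by (rule emeasure_density) simp_all
    also have "\<dots> = emeasure ?\<mu> (B \<inter> C)" by (rule nn_integral_indicator) simp
    also have "\<dots> = (\<integral>\<^sup>+u\<in>chart_map c ` (B \<inter> C). ennreal (\<nu> c (chart_inv c u)) \<partial>lborel)"
      using B by (intro rep(2)[OF c]) auto
    also have "\<dots> = (\<integral>\<^sup>+u. w u * indicator (chart_inv c -` C) u \<partial>lborel)"
    proof (intro nn_integral_cong)
      fix u
      have "u \<in> chart_map c ` (B \<inter> C) \<longleftrightarrow> u \<in> ?S \<and> chart_inv c u \<in> C"
        using c'(3) B(2) by (auto simp: subset_iff image_iff)
      then show "ennreal (\<nu> c (chart_inv c u)) * indicator (chart_map c ` (B \<inter> C)) u =
          w u * indicator (chart_inv c -` C) u"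
        unfolding w by (simp add: indicator_def)
    qed
    also have "\<dots> = emeasure (distr (density lborel w) borel (chart_inv c)) C"
      using measurable_sets[OF chart_inv_borel[OF chart[OF c]] C]
      by (subst emeasure_distr) (auto simp: emeasure_density)
    finally show "emeasure (density ?\<mu> (indicator B)) C =
        emeasure (distr (density lborel w) borel (chart_inv c)) C" .
  qed
  have "(\<integral>\<^sup>+x\<in>B. f x \<partial>?\<mu>) = (\<integral>\<^sup>+x. f x \<partial>density ?\<mu> (indicator B))"
    by (subst nn_integral_density) (auto simp: mult.commute)
  also have "\<dots> = (\<integral>\<^sup>+u. w u * f (chart_inv c u) \<partial>lborel)"
    unfolding eq by (subst nn_integral_distr) (auto simp: nn_integral_density)
  also have "\<dots> = (\<integral>\<^sup>+u\<in>?S. ennreal (\<nu> c (chart_inv c u)) * f (chart_inv c u) \<partial>lborel)"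
    unfolding w by (intro nn_integral_cong) (auto simp: indicator_def)
  finally show ?thesis .
qed

text \<open>The two measures agree on Borel subsets of charts. Thus forms that are multiples of
  \<open>\<nu>\<close> become densities over one fixed measure, which reduces functionals of them to
  ordinary integrals.\<close>

lemma form_measure_mult:
  assumes \<nu>: "volume_form A \<nu>" and f: "f \<in> borel_measurable borel" "\<And>x. 0 \<le> f x"
  shows "form_measure A (\<lambda>c x. f x * \<nu> c x) = density (form_measure A \<nu>) (\<lambda>x. ennreal (f x))"
proof (rule form_measure_eqI, unfold represents_def, intro conjI ballI impI)
  note sets = representsD(1)[OF represents_form_measure[OF \<nu>]]
  show "sets (density (form_measure A \<nu>) (\<lambda>x. ennreal (f x))) = sets borel" using sets by simp
  have f': "(\<lambda>x. ennreal (f x)) \<in> borel_measurable borel" using f(1) by simp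
  fix c B assume c: "c \<in> A" and B: "B \<in> sets borel" "B \<subseteq> chart_dom c"
  have "emeasure (density (form_measure A \<nu>) (\<lambda>x. ennreal (f x))) B =
      (\<integral>\<^sup>+x\<in>B. ennreal (f x) \<partial>form_measure A \<nu>)"
    using f' B(1) sets by (intro emeasure_density) (simp_all cong: measurable_cong_sets)
  also have "\<dots> = (\<integral>\<^sup>+u\<in>chart_map c ` B. ennreal (\<nu> c (chart_inv c u)) * ennreal (f (chart_inv c u)) \<partial>lborel)"
    by (rule set_nn_integral_form_measure[OF \<nu> f' c B])
  also have "\<dots> = (\<integral>\<^sup>+u\<in>chart_map c ` B. ennreal (f (chart_inv c u) * \<nu> c (chart_inv c u)) \<partial>lborel)"
  proof (intro nn_integral_cong)
    fix u
    show "ennreal (\<nu> c (chart_inv c u)) * ennreal (f (chart_inv c u)) * indicator (chart_map c ` B) u =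
        ennreal (f (chart_inv c u) * \<nu> c (chart_inv c u)) * indicator (chart_map c ` B) u"
      by (simp only: ennreal_mult'[OF f(2)] mult.commute)
  qed
  finally show "emeasure (density (form_measure A \<nu>) (\<lambda>x. ennreal (f x))) B =
      (\<integral>\<^sup>+u\<in>chart_map c ` B. ennreal (f (chart_inv c u) * \<nu> c (chart_inv c u)) \<partial>lborel)" .
qed

lemma continuous_on_UNIV_bounded:
  fixes f :: "'m \<Rightarrow> real"
  assumes "continuous_on UNIV f"
  obtains K where "K > 0" "\<And>x. \<bar>f x\<bar> \<le> K"
proof -
  have "compact (UNIV :: 'm set)"
    using compact_oriented unfolding compact_oriented_manifold_def by blast
  then have "bounded (range f)" using assms by (intro compact_imp_bounded compact_continuous_image)
  then obtain K where "K > 0" "\<forall>y\<in>range f. norm y \<le> K" by (auto simp: bounded_pos)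
  then show ?thesis using that by auto
qed

lemma Dens_measure:
  assumes "\<nu> \<in> Dens A"
  shows "volume_form A \<nu>" "finite_measure (form_measure A \<nu>)" "(\<integral>x. 1 \<partial>form_measure A \<nu>) = (1::real)"
    "sets (form_measure A \<nu>) = sets borel"
proof -
  show \<nu>: "volume_form A \<nu>" and 1: "(\<integral>x. 1 \<partial>form_measure A \<nu>) = (1::real)"
    using assms unfolding Dens_def linear_functional_def by auto
  \<comment> \<open>A non-integrable function has integral 0, so the value 1 already forces
    integrability, hence finite total mass.\<close>
  have "integrable (form_measure A \<nu>) (\<lambda>x. 1::real)"
    using 1 not_integrable_integral_eq by fastforce
  then show "finite_measure (form_measure A \<nu>)"
    by (intro finite_measureI) (auto simp: integrable_iff_bounded)
  show "sets (form_measure A \<nu>) = sets borel"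
    by (rule representsD(1)[OF represents_form_measure[OF \<nu>]])
qed

lemma continuous_integrable:
  fixes f :: "'m \<Rightarrow> real"
  assumes \<nu>: "\<nu> \<in> Dens A" and f: "continuous_on UNIV f"
  shows "integrable (form_measure A \<nu>) f"
proof -
  obtain K where "\<And>x. \<bar>f x\<bar> \<le> K" using continuous_on_UNIV_bounded[OF f] by blast
  moreover have "f \<in> borel_measurable (form_measure A \<nu>)"
    using borel_measurable_continuous_onI[OF f] Dens_measure(4)[OF \<nu>]
    by (simp cong: measurable_cong_sets)
  ultimately show ?thesis
    by (intro finite_measure.integrable_const_bound[OF Dens_measure(2)[OF \<nu>], of _ K]) auto
qed

lemma linear_functional_mult:
  fixes f g :: "'m \<Rightarrow> real"
  assumes \<nu>: "\<nu> \<in> Dens A" and f: "continuous_on UNIV f" "\<And>x. 0 \<le> f x" and g: "continuous_on UNIV g"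
  shows "linear_functional A g (\<lambda>c x. f x * \<nu> c x) = (\<integral>x. f x * g x \<partial>form_measure A \<nu>)"
  unfolding linear_functional_def
    form_measure_mult[OF Dens_measure(1)[OF \<nu>] borel_measurable_continuous_onI[OF f(1)] f(2)]
  using f(2) continuous_integrable[OF \<nu>] f(1) g
  by (subst integral_density) (auto intro: borel_measurable_integrable)

section \<open>The quotient of a form by a volume form\<close>

text \<open>The signed Radon-Nikodym density of \<open>\<delta>\<close> with respect to
  \<open>\<nu>\<close>. The coefficients of both forms transform by the same Jacobian, so their
  quotient is a function on the manifold, whichever chart is chosen.\<close>

definition form_ratio :: "('m, 'n) form \<Rightarrow> ('m, 'n) form \<Rightarrow> 'm \<Rightarrow> real" where
  "form_ratio \<delta> \<nu> x = (let c = (SOME c. c \<in> A \<and> x \<in> chart_dom c) in \<delta> c x / \<nu> c x)"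

lemma form_ratio_eq:
  assumes \<delta>: "top_form A \<delta>" and \<nu>: "volume_form A \<nu>" and c: "c \<in> A" "x \<in> chart_dom c"
  shows "form_ratio \<delta> \<nu> x = \<delta> c x / \<nu> c x"
proof -
  define d where "d = (SOME d. d \<in> A \<and> x \<in> chart_dom d)"
  have d: "d \<in> A" "x \<in> chart_dom d"
    using someI[of "\<lambda>d. d \<in> A \<and> x \<in> chart_dom d" c] c unfolding d_def by auto
  let ?J = "jacobian_det (coord_change c d) (chart_map c x)"
  have "\<nu> c x > 0" "\<nu> c x = ?J * \<nu> d x" "\<delta> c x = ?J * \<delta> d x"
    using \<delta> \<nu> c d unfolding volume_form_def top_form_def by blast+
  then show ?thesis
    unfolding form_ratio_def d_def[symmetric] Let_def by auto
qed

text \<open>Off the charts both coefficients are 0 by convention, so the identity holds for all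
  arguments and forms can be equated as functions.\<close>

lemma form_ratio_mult:
  assumes \<delta>: "top_form A \<delta>" and \<nu>: "volume_form A \<nu>"
  shows "form_ratio \<delta> \<nu> x * \<nu> c x = \<delta> c x"
proof (cases "c \<in> A \<and> x \<in> chart_dom c")
  case True
  then have "\<nu> c x > 0" using \<nu> unfolding volume_form_def by blast
  then show ?thesis using form_ratio_eq[OF \<delta> \<nu>, of c x] True by simp
next
  case False
  then have "\<nu> c x = 0" "\<delta> c x = 0"
    using \<delta> \<nu> unfolding volume_form_def top_form_def by blast+
  then show ?thesis by simp
qed

lemma form_ratio_continuous:
  assumes \<delta>: "top_form A \<delta>" and \<nu>: "volume_form A \<nu>"
  shows "continuous_on UNIV (form_ratio \<delta> \<nu>)"
proof (rule continuous_on_charts)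
  fix c assume c: "c \<in> A"
  have top: "top_form A \<nu>" and nz: "\<forall>x\<in>chart_dom c. \<nu> c x \<noteq> 0"
    using \<nu> c unfolding volume_form_def by force+
  have "continuous_on (chart_dom c) (\<lambda>x. \<delta> c x / \<nu> c x)"
    using nz by (intro continuous_on_divide continuous_on_chart_dom[OF c] top_form_continuous[OF _ c] \<delta> top)
  then show "continuous_on (chart_dom c) (form_ratio \<delta> \<nu>)"
    by (rule continuous_on_eq) (simp add: form_ratio_eq[OF \<delta> \<nu> c])
qed

text \<open>A volume form charges every nonempty open set: in a chart such a set has a nonempty
  open, hence non-negligible, image on which the coefficient is positive.\<close>

lemma continuous_AE_zero:
  fixes f :: "'m \<Rightarrow> real"
  assumes \<nu>: "volume_form A \<nu>" and f: "continuous_on UNIV f" and ae: "AE x in form_measure A \<nu>. f x = 0"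
  shows "f x = 0"
proof (rule ccontr)
  assume fx: "f x \<noteq> 0"
  obtain c where c: "c \<in> A" "x \<in> chart_dom c" by (rule chart_at)
  note c' = is_chartD[OF chart[OF c(1)]]
  define B where "B = {x. f x \<noteq> 0} \<inter> chart_dom c"
  have "open {x. f x \<noteq> 0}"
    using open_vimage[OF open_Compl[OF closed_singleton[of "0::real"]] f] by (simp add: vimage_def)
  then have B: "open B" "B \<subseteq> chart_dom c" "x \<in> B" using c'(1) c fx unfolding B_def by auto
  then have Bb: "B \<in> sets borel" by simp
  note rep = representsD[OF represents_form_measure[OF \<nu>]]
  let ?S = "chart_map c ` B"
  have top: "top_form A \<nu>" using \<nu> unfolding volume_form_def by simp
  have S: "open ?S" "?S \<noteq> {}" using open_chart_map_image[OF chart[OF c(1)] B(1,2)] B(3) by auto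
  have "{x. f x \<noteq> 0} \<in> null_sets (form_measure A \<nu>)"
    using ae \<open>open {x. f x \<noteq> 0}\<close> rep(1) by (subst (asm) AE_iff_null) (auto simp: sets_eq_imp_space_eq[OF rep(1)])
  then have "B \<in> null_sets (form_measure A \<nu>)"
    by (rule null_sets_subset) (use Bb rep(1) in \<open>auto simp: B_def\<close>)
  then have "0 = (\<integral>\<^sup>+u\<in>?S. ennreal (\<nu> c (chart_inv c u)) \<partial>lborel)"
    using rep(2)[OF c(1) Bb B(2)] by auto
  also have "\<dots> = (\<integral>\<^sup>+u. ennreal (chart_density c \<nu> u) * indicator ?S u \<partial>lborel)"
    using B(2) by (intro set_nn_integral_chart_density[OF chart[OF c(1)], symmetric] image_mono)
  finally have "AE u in lborel. ennreal (chart_density c \<nu> u) * indicator ?S u = 0"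
    using chart_density_measurable[OF chart[OF c(1)] top c(1)] S(1)
    by (subst (asm) eq_commute, subst (asm) nn_integral_0_iff_AE) auto
  moreover have "ennreal (chart_density c \<nu> u) * indicator ?S u \<noteq> 0" if "u \<in> ?S" for u
  proof -
    have u: "u \<in> chart_image c" using that B(2) by blast
    then have "\<nu> c (chart_inv c u) > 0" using \<nu> c(1) c'(5) unfolding volume_form_def by blast
    then show ?thesis using u that by (simp add: chart_density_def)
  qed
  ultimately have "AE u in lborel. u \<notin> ?S" by (auto elim: eventually_mono)
  then have "?S \<in> null_sets lborel"
    using S(1) by (subst (asm) AE_iff_null) auto
  then have "negligible ?S" by (simp add: negligible_iff_null_sets null_sets_completionI)
  then show False using S open_not_negligible by blast
qed


section \<open>Differentials and functional independence\<close>

lemma form_line_eq_mult: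
  assumes "top_form A \<delta>" "volume_form A \<nu>"
  shows "form_line \<nu> \<delta> t = (\<lambda>c x. (1 + t * form_ratio \<delta> \<nu> x) * \<nu> c x)"
proof (intro ext)
  fix c x
  have "(1 + t * form_ratio \<delta> \<nu> x) * \<nu> c x = \<nu> c x + t * (form_ratio \<delta> \<nu> x * \<nu> c x)"
    by (simp add: algebra_simps)
  then show "form_line \<nu> \<delta> t c x = (1 + t * form_ratio \<delta> \<nu> x) * \<nu> c x"
    unfolding form_line_def form_ratio_mult[OF assms] by simp
qed

text \<open>Along the line the measure has density
  \<open>1 + t * form_ratio \<delta> \<nu> x\<close> with respect to that of \<open>\<nu>\<close>,
  so the functional is affine in \<open>t\<close>.\<close>

lemma linear_functional_form_line:
  assumes \<nu>: "\<nu> \<in> Dens A" and \<delta>: "top_form A \<delta>" and g: "continuous_on UNIV g"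
    and line: "form_line \<nu> \<delta> t \<in> Dens A"
  shows "linear_functional A g (form_line \<nu> \<delta> t) =
    (\<integral>x. g x \<partial>form_measure A \<nu>) + t * (\<integral>x. form_ratio \<delta> \<nu> x * g x \<partial>form_measure A \<nu>)"
proof -
  note vol = Dens_measure(1)[OF \<nu>]
  let ?\<rho> = "form_ratio \<delta> \<nu>"
  have \<rho>: "continuous_on UNIV ?\<rho>" by (rule form_ratio_continuous[OF \<delta> vol])
  have eq: "form_line \<nu> \<delta> t = (\<lambda>c x. (1 + t * ?\<rho> x) * \<nu> c x)"
    by (rule form_line_eq_mult[OF \<delta> vol])
  \<comment> \<open>Positivity of the coefficients at both \<open>t\<close> and 0 determines the
    sign of their quotient.\<close>
  have nonneg: "0 \<le> 1 + t * ?\<rho> x" for x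
  proof -
    obtain c where c: "c \<in> A" "x \<in> chart_dom c" by (rule chart_at)
    have "form_line \<nu> \<delta> t c x > 0" "\<nu> c x > 0"
      using Dens_measure(1)[OF line] vol c unfolding volume_form_def by blast+
    then show ?thesis unfolding eq by (simp add: zero_less_mult_iff)
  qed
  have "linear_functional A g (form_line \<nu> \<delta> t) = (\<integral>x. (1 + t * ?\<rho> x) * g x \<partial>form_measure A \<nu>)"
    unfolding eq by (intro linear_functional_mult[OF \<nu> _ nonneg g] continuous_intros \<rho>)
  also have "\<dots> = (\<integral>x. g x + t * (?\<rho> x * g x) \<partial>form_measure A \<nu>)"
    by (simp add: algebra_simps)
  also have "\<dots> = (\<integral>x. g x \<partial>form_measure A \<nu>) + t * (\<integral>x. ?\<rho> x * g x \<partial>form_measure A \<nu>)"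
    using continuous_integrable[OF \<nu> g] continuous_integrable[OF \<nu> continuous_on_mult[OF \<rho> g]]
    by simp
  finally show ?thesis .
qed

lemma has_dens_differential_linear_functional:
  assumes \<nu>: "\<nu> \<in> Dens A" and g: "continuous_on UNIV g"
  shows "has_dens_differential A (linear_functional A g) \<nu>
    (\<lambda>\<delta>. \<integral>x. form_ratio \<delta> \<nu> x * g x \<partial>form_measure A \<nu>)"
  unfolding has_dens_differential_def
proof (intro conjI ballI allI)
  let ?\<mu> = "form_measure A \<nu>"
  note vol = Dens_measure(1)[OF \<nu>]
  show "((\<lambda>t. linear_functional A g (form_line \<nu> \<delta> t)) has_real_derivative
      (\<integral>x. form_ratio \<delta> \<nu> x * g x \<partial>?\<mu>)) (at 0)" if "\<delta> \<in> dens_tangent A \<nu>" for \<delta>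
  proof -
    have \<delta>: "top_form A \<delta>" and ev: "\<forall>\<^sub>F t in nhds 0. form_line \<nu> \<delta> t \<in> Dens A"
      using that unfolding dens_tangent_def by auto
    \<comment> \<open>The affine formula is available while the line stays in \<open>Dens\<close>,
      that is for \<open>t\<close> near 0, which is all that the derivative at 0 sees.\<close>
    have "\<forall>\<^sub>F t in nhds 0. linear_functional A g (form_line \<nu> \<delta> t) =
        (\<integral>x. g x \<partial>?\<mu>) + t * (\<integral>x. form_ratio \<delta> \<nu> x * g x \<partial>?\<mu>)"
      using ev by (rule eventually_mono) (rule linear_functional_form_line[OF \<nu> \<delta> g])
    moreover have "((\<lambda>t. (\<integral>x. g x \<partial>?\<mu>) + t * (\<integral>x. form_ratio \<delta> \<nu> x * g x \<partial>?\<mu>)) has_real_derivative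
        (\<integral>x. form_ratio \<delta> \<nu> x * g x \<partial>?\<mu>)) (at 0)"
      by (auto intro!: derivative_eq_intros)
    ultimately show ?thesis
      by (subst DERIV_cong_ev[OF refl _ refl]) auto
  qed
  fix \<delta> \<epsilon> a b assume "\<delta> \<in> dens_tangent A \<nu>" "\<epsilon> \<in> dens_tangent A \<nu>"
  then have top: "top_form A \<delta>" "top_form A \<epsilon>" unfolding dens_tangent_def by auto
  have "form_ratio (\<lambda>c x. a * \<delta> c x + b * \<epsilon> c x) \<nu> x * g x =
      a * (form_ratio \<delta> \<nu> x * g x) + b * (form_ratio \<epsilon> \<nu> x * g x)" for x
    unfolding form_ratio_def Let_def by (simp add: add_divide_distrib algebra_simps)
  then show "(\<integral>x. form_ratio (\<lambda>c x. a * \<delta> c x + b * \<epsilon> c x) \<nu> x * g x \<partial>?\<mu>) =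
      a * (\<integral>x. form_ratio \<delta> \<nu> x * g x \<partial>?\<mu>) + b * (\<integral>x. form_ratio \<epsilon> \<nu> x * g x \<partial>?\<mu>)"
    using top[THEN form_ratio_continuous, OF vol] g
    by (simp add: continuous_integrable[OF \<nu>] continuous_on_mult)
qed

lemma dens_tangent_smooth_mult:
  assumes \<nu>: "\<nu> \<in> Dens A" and f: "smooth_fun A f" and f0: "(\<integral>x. f x \<partial>form_measure A \<nu>) = 0"
  shows "(\<lambda>c x. f x * \<nu> c x) \<in> dens_tangent A \<nu>"
proof -
  let ?\<mu> = "form_measure A \<nu>" and ?\<delta> = "\<lambda>c x. f x * \<nu> c x"
  have \<nu>v: "volume_form A \<nu>" and \<nu>t: "top_form A \<nu>"
    using Dens_measure(1)[OF \<nu>] unfolding volume_form_def by auto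
  have fc: "continuous_on UNIV f" by (rule smooth_fun_continuous[OF f])
  obtain K where K: "K > 0" "\<And>x. \<bar>f x\<bar> \<le> K" by (rule continuous_on_UNIV_bounded[OF fc]) blast
  \<comment> \<open>The bound \<open>1 / K\<close> keeps \<open>t * f x\<close> above -1, so the
    coefficients stay positive; the mass stays 1 because \<open>f\<close> has mean 0.\<close>
  have "form_line \<nu> ?\<delta> t \<in> Dens A" if t: "\<bar>t\<bar> < 1 / K" for t
  proof -
    have pos: "0 < 1 + t * f x" for x
    proof -
      have "\<bar>t * f x\<bar> \<le> \<bar>t\<bar> * K" using K(2)[of x] by (simp add: abs_mult mult_left_mono)
      also have "\<dots> < 1" using t K(1) by (simp add: field_simps)
      finally show ?thesis by linarith
    qed
    have eq: "form_line \<nu> ?\<delta> t = (\<lambda>c x. (1 + t * f x) * \<nu> c x)"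
      unfolding form_line_def by (simp add: algebra_simps)
    have "smooth_fun A (\<lambda>x. 1 + t * f x)"
      by (intro smooth_fun_add smooth_fun_mult smooth_fun_const f)
    then have "top_form A (form_line \<nu> ?\<delta> t)"
      unfolding eq by (rule top_form_smooth_mult[OF _ \<nu>t])
    moreover have "form_line \<nu> ?\<delta> t c x > 0" if "c \<in> A" "x \<in> chart_dom c" for c x
      unfolding eq using \<nu>v that pos unfolding volume_form_def by (simp add: mult_pos_pos)
    moreover have "linear_functional A (\<lambda>x. 1) (form_line \<nu> ?\<delta> t) = (\<integral>x. (1 + t * f x) * 1 \<partial>?\<mu>)"
      unfolding eq by (intro linear_functional_mult[OF \<nu>] continuous_intros fc less_imp_le[OF pos])
    moreover have "(\<integral>x. (1 + t * f x) * 1 \<partial>?\<mu>) = 1"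
      using Dens_measure(3)[OF \<nu>] f0 continuous_integrable[OF \<nu> fc]
        continuous_integrable[OF \<nu> continuous_on_const[of _ "1::real"]] by simp
    ultimately show ?thesis unfolding Dens_def volume_form_def by simp
  qed
  moreover have "\<forall>\<^sub>F t in nhds 0. \<bar>t\<bar> < 1 / K"
    using K(1) unfolding eventually_nhds_metric by (intro exI[of _ "1 / K"]) (auto simp: dist_real_def)
  ultimately have "\<forall>\<^sub>F t in nhds 0. form_line \<nu> ?\<delta> t \<in> Dens A"
    by (auto elim: eventually_mono)
  then show ?thesis
    unfolding dens_tangent_def using top_form_smooth_mult[OF f \<nu>t] by blast
qed

lemma const_if_orthogonal_to_tangents:
  assumes \<nu>: "\<nu> \<in> Dens A" and g: "smooth_fun A g"
    and orth: "\<And>\<delta>. \<delta> \<in> dens_tangent A \<nu> \<Longrightarrow> (\<integral>x. form_ratio \<delta> \<nu> x * g x \<partial>form_measure A \<nu>) = 0"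
  shows "\<exists>m. \<forall>x. g x = m"
proof -
  let ?\<mu> = "form_measure A \<nu>"
  define m where "m = (\<integral>x. g x \<partial>?\<mu>)"
  define f where "f x = g x + - m" for x
  have \<nu>v: "volume_form A \<nu>" by (rule Dens_measure(1)[OF \<nu>])
  have gc: "continuous_on UNIV g" by (rule smooth_fun_continuous[OF g])
  have f: "smooth_fun A f" unfolding f_def by (intro smooth_fun_add smooth_fun_const g)
  then have fc: "continuous_on UNIV f" by (rule smooth_fun_continuous)
  note int = continuous_integrable[OF \<nu>]
  have int1: "integrable ?\<mu> (\<lambda>x. 1::real)" by (intro int continuous_on_const)
  have f0: "(\<integral>x. f x \<partial>?\<mu>) = 0"
  proof -
    have "(\<integral>x. f x \<partial>?\<mu>) = (\<integral>x. g x + - m * 1 \<partial>?\<mu>)" unfolding f_def by simp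
    also have "\<dots> = (\<integral>x. g x \<partial>?\<mu>) + - m * (\<integral>x. 1 \<partial>?\<mu>)"
      using int[OF gc] int1 by (subst Bochner_Integration.integral_add) (simp_all only: integrable_mult_right integral_mult_right_zero simp_thms)
    finally show ?thesis using Dens_measure(3)[OF \<nu>] unfolding m_def by simp
  qed
  let ?\<delta> = "\<lambda>c x. f x * \<nu> c x"
  have \<delta>: "?\<delta> \<in> dens_tangent A \<nu>" by (rule dens_tangent_smooth_mult[OF \<nu> f f0])
  have ratio: "form_ratio ?\<delta> \<nu> x = f x" for x
  proof -
    obtain c where c: "c \<in> A" "x \<in> chart_dom c" by (rule chart_at)
    have "\<nu> c x > 0" using \<nu>v c unfolding volume_form_def by blast
    moreover have "top_form A ?\<delta>" using \<delta> unfolding dens_tangent_def by blast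
    ultimately show ?thesis using form_ratio_eq[OF _ \<nu>v c] by simp
  qed
  \<comment> \<open>\<open>f\<close> is orthogonal to \<open>g\<close> by \<open>orth\<close> at the
    tangent vector \<open>?\<delta>\<close>, whose quotient is \<open>f\<close>, and to constants by
    \<open>f0\<close>; so it is orthogonal to itself.\<close>
  have "(\<integral>x. f x * f x \<partial>?\<mu>) = (\<integral>x. f x * g x + - m * f x \<partial>?\<mu>)"
    by (simp add: f_def algebra_simps)
  also have "\<dots> = (\<integral>x. f x * g x \<partial>?\<mu>) + - m * (\<integral>x. f x \<partial>?\<mu>)"
    using int[OF continuous_on_mult[OF fc gc]] int[OF fc] by simp
  also have "\<dots> = 0" using orth[OF \<delta>] f0 by (simp add: ratio)
  finally have "(\<integral>x. f x * f x \<partial>?\<mu>) = 0" .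
  then have "AE x in ?\<mu>. f x * f x = 0"
    using integral_nonneg_eq_0_iff_AE[OF int[OF continuous_on_mult[OF fc fc]]] by simp
  then have "f x = 0" for x
    by (intro continuous_AE_zero[OF \<nu>v fc]) auto
  then show ?thesis unfolding f_def by (metis add.right_inverse add_right_cancel)
qed

lemma powers_functionally_independent:
  assumes l: "smooth_fun A l" and nonconst: "\<not> (\<exists>k. \<forall>x. l x = k)"
  shows "functionally_independent A (\<lambda>i. casimir_functional A (\<lambda>y. y ^ Suc i) l)"
  unfolding functionally_independent_def
proof
  fix \<nu> assume \<nu>: "\<nu> \<in> Dens A"
  let ?\<mu> = "form_measure A \<nu>"
  let ?D = "\<lambda>i \<delta>. \<integral>x. form_ratio \<delta> \<nu> x * l x ^ Suc i \<partial>?\<mu>"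
  have lc: "continuous_on UNIV l" by (rule smooth_fun_continuous[OF l])
  show "\<exists>D. (\<forall>i. has_dens_differential A (casimir_functional A (\<lambda>y. y ^ Suc i) l) \<nu> (D i)) \<and>
      (\<forall>N a. (\<forall>\<delta>\<in>dens_tangent A \<nu>. (\<Sum>i<N. a i * D i \<delta>) = 0) \<longrightarrow> (\<forall>i<N. a i = 0))"
  proof (intro exI[of _ ?D] conjI allI impI)
    show "has_dens_differential A (casimir_functional A (\<lambda>y. y ^ Suc i) l) \<nu> (?D i)" for i
      unfolding casimir_functional_def comp_def
      by (intro has_dens_differential_linear_functional[OF \<nu>] continuous_on_power lc)
    fix N :: nat and a :: "nat \<Rightarrow> real" and j
    assume orth: "\<forall>\<delta>\<in>dens_tangent A \<nu>. (\<Sum>i<N. a i * ?D i \<delta>) = 0" and j: "j < N"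
    define g where "g x = (\<Sum>i<N. a i * l x ^ Suc i)" for x
    have g: "smooth_fun A g"
      unfolding g_def by (intro smooth_fun_sum smooth_fun_mult smooth_fun_const smooth_fun_power l)
    have "(\<integral>x. form_ratio \<delta> \<nu> x * g x \<partial>?\<mu>) = 0" if \<delta>: "\<delta> \<in> dens_tangent A \<nu>" for \<delta>
    proof -
      have \<rho>: "continuous_on UNIV (form_ratio \<delta> \<nu>)"
        using \<delta> Dens_measure(1)[OF \<nu>] by (intro form_ratio_continuous) (auto simp: dens_tangent_def)
      have int: "integrable ?\<mu> (\<lambda>x. form_ratio \<delta> \<nu> x * l x ^ Suc i)" for i
        by (intro continuous_integrable[OF \<nu>] continuous_on_mult continuous_on_power \<rho> lc)
      have "(\<integral>x. form_ratio \<delta> \<nu> x * g x \<partial>?\<mu>) =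
          (\<integral>x. (\<Sum>i<N. a i * (form_ratio \<delta> \<nu> x * l x ^ Suc i)) \<partial>?\<mu>)"
        unfolding g_def by (simp add: sum_distrib_left mult.left_commute)
      also have "\<dots> = (\<Sum>i<N. a i * ?D i \<delta>)"
        using int by (subst Bochner_Integration.integral_sum) (auto simp del: power_Suc)
      finally show ?thesis using orth \<delta> by simp
    qed
    then obtain m where m: "\<And>x. g x = m" using const_if_orthogonal_to_tangents[OF \<nu> g] by blast
    \<comment> \<open>Coefficients of the polynomial that turns the equation \<open>g x = m\<close>
      into a root condition: \<open>a i\<close> belongs to degree \<open>Suc i\<close>, and degree 0
      takes \<open>- m\<close>.\<close>
    define b where "b i = (case i of 0 \<Rightarrow> - m | Suc i \<Rightarrow> a i)" for i
    have root: "(\<Sum>i\<le>N. b i * l x ^ i) = 0" for x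
    proof -
      have "(\<Sum>i\<le>N. b i * l x ^ i) = - m + (\<Sum>i<N. a i * l x ^ Suc i)"
        by (subst sum.atMost_shift) (simp add: b_def)
      then show ?thesis using m[of x] unfolding g_def by simp
    qed
    have "infinite (range l)"
    proof
      assume fin: "finite (range l)"
      have "connected (range l)"
        using compact_oriented lc unfolding compact_oriented_manifold_def
        by (intro connected_continuous_image) auto
      then obtain k where "range l = {k}"
        using fin connected_finite_iff_sing by fastforce
      then show False using nonconst by blast
    qed
    then have "infinite {y. (\<Sum>i\<le>N. b i * y ^ i) = 0}"
      using root by (elim infinite_super[rotated]) auto
    \<comment> \<open>Infinitely many roots annihilate every coefficient of index at most
      \<open>N\<close>, and \<open>j < N\<close> puts \<open>Suc j\<close> in this range.\<close>
    then have "b (Suc j) = 0" using j unfolding polyfun_finite_roots by auto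
    then show "a j = 0" unfolding b_def by simp
  qed
qed

end

theorem mainTheorem2:
  fixes A :: "('m::t2_space, 'n::{finite,wellorder}) chart set"
    and P :: "('m \<Rightarrow> real) \<Rightarrow> ('m \<Rightarrow> real) \<Rightarrow> ('m \<Rightarrow> real)"
    and l :: "'m \<Rightarrow> real"
  assumes "compact_oriented_manifold A"
    and "poisson_bracket A P"
    and "leaves_codim_ge_1 A P"
    and "smooth_fun A l"
    and "casimir A P l"
    and "\<not> (\<exists>k. \<forall>x. l x = k)"
  shows "(\<exists>H :: nat \<Rightarrow> real \<Rightarrow> real.
            (\<forall>i. dens_casimir A P (casimir_functional A (H i) l)) \<and>
            functionally_independent A (\<lambda>i. casimir_functional A (H i) l)) \<and>
         (\<forall>h :: real \<Rightarrow> real. dens_casimir A P (casimir_functional A h l))"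
proof -
  interpret compact_oriented A by standard (rule assms(1))
  have "dens_casimir A P (casimir_functional A h l)" for h
    by (rule casimir_functional_dens_casimir[OF assms(5)])
  then show ?thesis
    using powers_functionally_independent[OF assms(4,6)] by (intro conjI exI[of _ "\<lambda>i y. y ^ Suc i"]) auto
qed

end
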